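(* Let $p$ be a prime and let $c$ be an integer. Then \[ \sum_{\substack{r\in\mathbb{Z},\ |r|<2\sqrt p,\\ r\equiv c\pmod 3}}H(4p-r^2) =\begin{cases} \frac{p+1}{2}, &\text{if } c\equiv 0\pmod 3,\ p\equiv 1\pmod 3,\\ p-1, &\text{if } c\equiv 0\pmod 3,\ p\equiv 2\pmod 3,\\ \frac{3p-1}{4}, &\text{if } c\equiv\pm 1\pmod 3,\ p\equiv 1\pmod 3,\\ \frac{p+1}{2}, &\text{if } c\equiv\pm 1\pmod 3,\ p\equiv 2\pmod 3. \end{cases} \]
   Context: $H(N)$ denotes the Hurwitz class number: for an integer $N\ge 0$, $H(0)=-1/12$; $H(N)=0$ if $N\equiv 1,2\pmod 4$; otherwise $H(N)$ is the number of $\mathrm{SL}_2(\mathbb{Z})$-equivalence classes of (not necessarily primitive) positive definite binary quadratic forms of discriminant $-N$, where classes containing a multiple of $x^2+y^2$ are counted with weight $1/2$ and classes containing a multiple of $x^2+xy+y^2$ are counted with weight $1/3$. The sum runs over all integers $r$ (positive, negative and zero) satisfying the stated conditions. *)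

theory Defs
  imports Complex_Main "HOL-Computational_Algebra.Primes"
begin

text \<open>Integral binary quadratic forms a x^2 + b x y + c y^2, represented as triples (a,b,c).\<close>
type_synonym qform = "int \<times> int \<times> int"

definition disc :: "qform \<Rightarrow> int" where
  "disc Q = (case Q of (a, b, c) \<Rightarrow> b^2 - 4*a*c)"

definition pos_def :: "qform \<Rightarrow> bool" where
  "pos_def Q = (case Q of (a, b, c) \<Rightarrow> a > 0 \<and> b^2 - 4*a*c < 0)"

text \<open>The form Q(\<alpha> x + \<beta> y, \<gamma> x + \<delta> y).\<close>
definition act :: "int \<Rightarrow> int \<Rightarrow> int \<Rightarrow> int \<Rightarrow> qform \<Rightarrow> qform" where
  "act \<alpha> \<beta> \<gamma> \<delta> Q = (case Q of (a, b, c) \<Rightarrow>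
     (a*\<alpha>^2 + b*\<alpha>*\<gamma> + c*\<gamma>^2,
      2*a*\<alpha>*\<beta> + b*(\<alpha>*\<delta> + \<beta>*\<gamma>) + 2*c*\<gamma>*\<delta>,
      a*\<beta>^2 + b*\<beta>*\<delta> + c*\<delta>^2))"

definition sl2_equiv :: "qform rel" where
  "sl2_equiv = {(Q, Q'). \<exists>\<alpha> \<beta> \<gamma> \<delta>. \<alpha>*\<delta> - \<beta>*\<gamma> = 1 \<and> act \<alpha> \<beta> \<gamma> \<delta> Q = Q'}"

definition forms_disc :: "nat \<Rightarrow> qform set" where
  "forms_disc N = {Q. pos_def Q \<and> disc Q = - int N}"

definition form_classes :: "nat \<Rightarrow> qform set set" where
  "form_classes N = forms_disc N // (sl2_equiv \<inter> (forms_disc N \<times> forms_disc N))"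

definition class_weight :: "qform set \<Rightarrow> real" where
  "class_weight C =
     (if \<exists>k. (k, 0, k) \<in> C then 1/2
      else if \<exists>k. (k, k, k) \<in> C then 1/3
      else 1)"

definition hurwitz :: "nat \<Rightarrow> real" where
  "hurwitz N =
     (if N = 0 then - 1/12
      else if N mod 4 = 1 \<or> N mod 4 = 2 then 0
      else (\<Sum>C\<in>form_classes N. class_weight C))"

end

theory Submission
  imports Defs
begin

text \<open>
A form of discriminant \<open>r\<^sup>2 - 4p\<close> is the same thing as an integral matrix M with rows (A, B) and (C, D), determinant p
and trace r, namely (C, D - A, -B); the root of the form is the fixed point of M in the upper half plane. So the sum
counts, with weights, the elliptic matrices of determinant p whose fixed point lies in the ideal triangle with vertices
0, 1 and infinity (three copies of a fundamental domain), with a condition on the trace.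

Let U be the rotation of order 3 of that triangle, and let S be the half turn about the edge joining 0 and infinity. A
sign \<open>\<tau>\<close>(M) records on which side of this edge the fixed point lies; for hyperbolic M one takes the attracting
fixed point. Adding up \<open>\<tau>\<close> over the three conjugates of M by powers of U detects the triangle. Since conjugation by S
changes the sign of \<open>\<tau>\<close>, one may replace \<open>\<tau>\<close> by any function that is cheaper to sum, has the same antisymmetry and
differs from \<open>\<tau>\<close> at finitely many matrices of determinant p only. Three such replacements use the position of the
images under M of some cusps instead of the fixed point.

The images of 0 and infinity give 2p for the sum over all traces. The images of 0, 1 and infinity together are insensitive to
right multiplication by U; for p = 1 (mod 3) this shows that one third of the total count comes from the matrices whose
reduction modulo 3 lies in the quaternion subgroup. The image of a cusp that is congruent modulo 3 to a line fixed by M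
evaluates the count weighted by the number of fixed lines over the field with three elements. The condition that 3 divides
the trace is a linear combination of these three weights if p = 1 (mod 3), and half the last one if p = 2 (mod 3).
\<close>

subsection \<open>Sums of functions with finite support\<close>

text \<open>The value is 0 if the support is infinite.\<close>
definition fsum :: "'a set \<Rightarrow> ('a \<Rightarrow> int) \<Rightarrow> int" where
  "fsum X f = (\<Sum>x\<in>{x\<in>X. f x \<noteq> 0}. f x)"

definition fin_supp :: "'a set \<Rightarrow> ('a \<Rightarrow> int) \<Rightarrow> bool" where
  "fin_supp X f \<longleftrightarrow> finite {x\<in>X. f x \<noteq> 0}"

lemma fsum_eq_sum:
  assumes "finite Y" "Y \<subseteq> X" "\<And>x. x \<in> X \<Longrightarrow> f x \<noteq> 0 \<Longrightarrow> x \<in> Y"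
  shows "fsum X f = sum f Y"
  unfolding fsum_def using assms by (intro sum.mono_neutral_left) auto

lemma fin_suppI:
  assumes "finite Y" "\<And>x. x \<in> X \<Longrightarrow> f x \<noteq> 0 \<Longrightarrow> x \<in> Y"
  shows "fin_supp X f"
  unfolding fin_supp_def by (rule finite_subset[OF _ assms(1)]) (use assms(2) in auto)

lemma fsum_cong: "(\<And>x. x \<in> X \<Longrightarrow> f x = g x) \<Longrightarrow> fsum X f = fsum X g"
  unfolding fsum_def by (intro sum.cong) auto

lemma fin_supp_cong: "(\<And>x. x \<in> X \<Longrightarrow> f x = g x) \<Longrightarrow> fin_supp X f = fin_supp X g"
  unfolding fin_supp_def by (intro arg_cong[where f = finite]) auto

lemma fin_supp_add:
  assumes "fin_supp X f" "fin_supp X g" shows "fin_supp X (\<lambda>x. f x + g x)"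
  by (rule fin_suppI[OF finite_UnI[OF assms[unfolded fin_supp_def]]]) auto

lemma fin_supp_diff:
  assumes "fin_supp X f" "fin_supp X g" shows "fin_supp X (\<lambda>x. f x - g x)"
  by (rule fin_suppI[OF finite_UnI[OF assms[unfolded fin_supp_def]]]) auto

lemma fin_supp_mult:
  assumes "fin_supp X f" shows "fin_supp X (\<lambda>x. h x * f x)"
  by (rule fin_suppI[OF assms[unfolded fin_supp_def]]) auto

lemma fsum_add:
  assumes "fin_supp X f" "fin_supp X g"
  shows "fsum X (\<lambda>x. f x + g x) = fsum X f + fsum X g"
proof -
  let ?Y = "{x\<in>X. f x \<noteq> 0} \<union> {x\<in>X. g x \<noteq> 0}"
  have fin: "finite ?Y" using assms by (auto simp: fin_supp_def)
  have "fsum X (\<lambda>x. f x + g x) = sum (\<lambda>x. f x + g x) ?Y" "fsum X f = sum f ?Y" "fsum X g = sum g ?Y"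
    using fin by (intro fsum_eq_sum; auto)+
  then show ?thesis by (simp add: sum.distrib)
qed

lemma fsum_mult: "fsum X (\<lambda>x. c * f x) = c * fsum X f"
  by (cases "c = 0") (simp_all add: fsum_def sum_distrib_left)

lemma fsum_uminus: "fsum X (\<lambda>x. - f x) = - fsum X f"
  using fsum_mult[of X "-1" f] by simp

lemma fsum_diff:
  assumes "fin_supp X f" "fin_supp X g"
  shows "fsum X (\<lambda>x. f x - g x) = fsum X f - fsum X g"
  using fsum_add[OF assms(1) fin_supp_mult[OF assms(2), of "\<lambda>_. -1"]] fsum_uminus[of X g] by simp

lemma
  assumes "bij_betw h X X"
  shows fsum_bij: "fsum X (\<lambda>x. f (h x)) = fsum X f"
    and fin_supp_bij: "fin_supp X (\<lambda>x. f (h x)) = fin_supp X f"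
proof -
  have *: "bij_betw h {x\<in>X. f (h x) \<noteq> 0} {x\<in>X. f x \<noteq> 0}"
    using assms unfolding bij_betw_def inj_on_def by (auto 0 3)
  show "fsum X (\<lambda>x. f (h x)) = fsum X f"
    unfolding fsum_def by (rule sum.reindex_bij_betw[OF *])
  show "fin_supp X (\<lambda>x. f (h x)) = fin_supp X f"
    unfolding fin_supp_def by (rule bij_betw_finite[OF *])
qed

subsection \<open>Matrices of fixed determinant\<close>

text \<open>The quadruple (A, B, C, D) stands for the matrix with rows (A, B) and (C, D). Below, U has rows (0, -1) and (1, -1),
  and S has rows (0, -1) and (1, 0).\<close>
type_synonym mat2 = "int \<times> int \<times> int \<times> int"

definition mats :: "int \<Rightarrow> mat2 set" where
  "mats p = {(A, B, C, D). A * D - B * C = p}"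

fun leftU :: "mat2 \<Rightarrow> mat2" where "leftU (A, B, C, D) = (-C, -D, A - C, B - D)"
fun rightU :: "mat2 \<Rightarrow> mat2" where "rightU (A, B, C, D) = (B, -A-B, D, -C-D)"
fun rightS :: "mat2 \<Rightarrow> mat2" where "rightS (A, B, C, D) = (B, -A, D, -C)"
fun conjU :: "mat2 \<Rightarrow> mat2" where "conjU (A, B, C, D) = (C + D, -C, C + D - A - B, A - C)"
fun conjS :: "mat2 \<Rightarrow> mat2" where "conjS (A, B, C, D) = (D, -C, -B, A)"

lemma leftU_cube: "leftU (leftU (leftU M)) = M" by (cases M) auto
lemma rightU_cube: "rightU (rightU (rightU M)) = M" by (cases M) auto
lemma conjU_cube: "conjU (conjU (conjU M)) = M" by (cases M) auto
lemma conjS_conjS: "conjS (conjS M) = M" by (cases M) auto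
lemma conjU_eq: "conjU M = leftU (rightU (rightU M))" by (cases M) auto
lemma leftU_rightU: "rightU (leftU M) = leftU (rightU M)" by (cases M) auto

lemma mats_closed:
  assumes "M \<in> mats p"
  shows "leftU M \<in> mats p" "rightU M \<in> mats p" "rightS M \<in> mats p" "conjU M \<in> mats p" "conjS M \<in> mats p"
  using assms by (cases M; simp add: mats_def algebra_simps)+

lemma bij_mats:
  "bij_betw leftU (mats p) (mats p)" "bij_betw rightU (mats p) (mats p)"
  "bij_betw rightS (mats p) (mats p)"
  "bij_betw conjU (mats p) (mats p)" "bij_betw conjS (mats p) (mats p)"
proof -
  have *: "bij_betw h (mats p) (mats p)"
    if "\<And>M. M \<in> mats p \<Longrightarrow> h M \<in> mats p \<and> k M \<in> mats p" "\<And>M. k (h M) = M" "\<And>M. h (k M) = M"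
    for h k by (rule bij_betw_byWitness[where f' = k]) (use that in auto)
  have **: "rightS (rightS (rightS (rightS M))) = M" for M by (cases M) auto
  show "bij_betw leftU (mats p) (mats p)"
    by (rule *[of _ "\<lambda>M. leftU (leftU M)"]) (simp_all add: mats_closed leftU_cube)
  show "bij_betw rightU (mats p) (mats p)"
    by (rule *[of _ "\<lambda>M. rightU (rightU M)"]) (simp_all add: mats_closed rightU_cube)
  show "bij_betw rightS (mats p) (mats p)"
    by (rule *[of _ "\<lambda>M. rightS (rightS (rightS M))"]) (simp_all add: mats_closed **)
  show "bij_betw conjU (mats p) (mats p)"
    by (rule *[of _ "\<lambda>M. conjU (conjU M)"]) (simp_all add: mats_closed conjU_cube)
  show "bij_betw conjS (mats p) (mats p)"
    by (rule *[of _ conjS]) (simp_all add: mats_closed conjS_conjS)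
qed

text \<open>If \<open>BC < 0\<close>, the fixed points of M lie on the side of the imaginary axis given by the sign of \<open>C (A - D)\<close>. If
  \<open>BC > 0\<close>, they are real and of opposite signs, and the second sign is that of the attracting one. The value for \<open>BC = 0\<close>
  is a convention.\<close>
fun tau :: "mat2 \<Rightarrow> int" where
  "tau (A, B, C, D) = (if B * C < 0 then sgn (C * (A - D)) else sgn ((A + D) * (B + C)))"

text \<open>The common sign of the images B/D and A/C of 0 and infinity; an image that is itself 0 or infinity is ignored.\<close>
fun eta :: "mat2 \<Rightarrow> int" where "eta (A, B, C, D) = sgn (sgn (A * C) + sgn (B * D))"

text \<open>The third term is the image \<open>(A + B) / (C + D)\<close> of the cusp 1, so that all
  three vertices of the ideal triangle enter symmetrically.\<close>

fun maj :: "mat2 \<Rightarrow> int" where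
  "maj (A, B, C, D) = sgn (sgn (A * C) + sgn (B * D) + sgn ((A + B) * (C + D)))"

text \<open>For \<open>\<tau>\<close> this is twice the indicator function of the fixed point lying in the ideal triangle (with one half on its
  boundary), unless a fixed point is one of the vertices.\<close>
definition cyc :: "(mat2 \<Rightarrow> int) \<Rightarrow> mat2 \<Rightarrow> int" where
  "cyc f M = f M + f (conjU M) + f (conjU (conjU M)) - 1"

section \<open>Comparison of the fixed point sign with the images of 0 and infinity\<close>

definition box :: "int \<Rightarrow> mat2 set" where
  "box n = {-n..n} \<times> {-n..n} \<times> {-n..n} \<times> {-n..n}"

lemma finite_box: "finite (box n)" by (simp add: box_def)

lemma tau_conjS: "tau (conjS M) = - tau M"
proof (cases M)
  case (fields A B C D)
  show ?thesis unfolding fields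
    by (auto simp: sgn_mult mult.commute sgn_if mult_less_0_iff zero_less_mult_iff)
qed

lemma prod_le_imp_abs_le:
  fixes x y :: int assumes "\<bar>x * y\<bar> \<le> n" "x \<noteq> 0" "y \<noteq> 0" shows "\<bar>x\<bar> \<le> n" "\<bar>y\<bar> \<le> n"
proof -
  have "\<bar>x\<bar> * 1 \<le> \<bar>x\<bar> * \<bar>y\<bar>" "1 * \<bar>y\<bar> \<le> \<bar>x\<bar> * \<bar>y\<bar>"
    using assms(2,3) by (intro mult_mono; linarith)+
  then show "\<bar>x\<bar> \<le> n" "\<bar>y\<bar> \<le> n" using assms(1) by (auto simp: abs_mult)
qed

text \<open>\<open>A * D\<close> and \<open>- B * C\<close> are then two positive integers with sum
  p, so every entry is bounded by p.\<close>

lemma box_if_opposite: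
  assumes "(A, B, C, D) \<in> mats p" "A * D > 0" "B * C < 0"
  shows "(A, B, C, D) \<in> box p"
proof -
  have *: "\<bar>A * D\<bar> \<le> p" "\<bar>B * C\<bar> \<le> p" using assms by (auto simp: mats_def)
  have nz: "A \<noteq> 0" "B \<noteq> 0" "C \<noteq> 0" "D \<noteq> 0" using assms by auto
  show ?thesis
    using prod_le_imp_abs_le[OF *(1)] prod_le_imp_abs_le[OF *(2)] nz by (auto simp: box_def abs_le_iff)
qed

lemma int_sign_cases: "(x::int) < 0 \<and> sgn x = -1 \<or> x = 0 \<and> sgn x = 0 \<or> x > 0 \<and> sgn x = 1"
  by (auto simp: sgn_if)

text \<open>A check of signs. If \<open>B * C \<ge> 0\<close>, then \<open>A * C\<close> and
  \<open>B * D\<close> cannot have opposite signs. If \<open>A * D \<le> 0\<close>, the signs of A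
  and D already determine the sign of \<open>A - D\<close>.\<close>

lemma tau_eq_eta:
  assumes "(A, B, C, D) \<in> mats p" "p > 0" "\<not> (A * D > 0 \<and> B * C < 0)"
  shows "tau (A, B, C, D) = eta (A, B, C, D)"
proof -
  consider "A * D > 0" "B * C > 0" | "A * D > 0" "B * C = 0" | "A * D \<le> 0" "B * C < 0"
    using assms by (force simp: mats_def not_less)
  then show ?thesis
  proof cases
    case 1
    then show ?thesis by (auto simp: zero_less_mult_iff sgn_mult mult_less_0_iff)
  next
    case 2
    then show ?thesis by (auto simp: zero_less_mult_iff sgn_mult)
  next
    case 3
    then show ?thesis
      using int_sign_cases[of A] int_sign_cases[of D] int_sign_cases[of "A - D"]
      by (elim disjE conjE) (auto simp: mult_less_0_iff sgn_mult mult_le_0_iff)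
  qed
qed

lemma fin_supp_tau_eta:
  assumes "p > 0" shows "fin_supp (mats p) (\<lambda>M. tau M - eta M)"
proof (rule fin_suppI[OF finite_box[of p]])
  fix M assume M: "M \<in> mats p" "tau M - eta M \<noteq> 0"
  obtain A B C D where "M = (A, B, C, D)" by (cases M)
  with M show "M \<in> box p"
    using box_if_opposite[of A B C D p] tau_eq_eta[of A B C D p] assms by (auto simp del: tau.simps eta.simps)
qed

subsection \<open>The sign of the fixed point and the ideal triangle\<close>

text \<open>Some fixed point of the matrix is one of the cusps 0, 1 and infinity.\<close>
fun some_zero :: "mat2 \<Rightarrow> bool" where
  "some_zero (A, B, C, D) \<longleftrightarrow> C = 0 \<or> B = 0 \<or> C + D - A - B = 0"

text \<open>The sign \<open>\<tau>\<close> in terms of the values x, y, z of the form (C, D - A, -B) at the vectors of a superbase, and of the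
  trace t; conjugation by U permutes x, y, z cyclically.\<close>
definition tau_form :: "int \<Rightarrow> int \<Rightarrow> int \<Rightarrow> int \<Rightarrow> int" where
  "tau_form x y z t = (if x * y > 0 then sgn x * sgn (x + y - z) else sgn t * sgn (x - y))"

lemma tau_eq_form: "tau (A, B, C, D) = tau_form C (-B) (C + D - A - B) (A + D)"
proof -
  have "sgn ((A + D) * (B + C)) = sgn (A + D) * sgn (C - - B)" "sgn (C * (A - D)) = sgn C * sgn (C + - B - (C + D - A - B))"
    by (simp_all add: sgn_mult add.commute)
  then show ?thesis
    unfolding tau_form_def tau.simps by (simp add: mult.commute)
qed

lemma cyc_tau:
  "cyc tau (A, B, C, D) = tau_form C (-B) (C + D - A - B) (A + D) + tau_form (C + D - A - B) C (-B) (A + D)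
     + tau_form (-B) (C + D - A - B) C (A + D) - 1"
  unfolding cyc_def conjU.simps tau_eq_form by (simp add: algebra_simps)

text \<open>Both identities compute the discriminant \<open>(A + D)^2 - 4 * p\<close> of the form
  (C, D - A, -B). The second uses its Selling parameters, whose pairwise products add up to minus
  the discriminant.\<close>

lemma disc_identity:
  assumes "(A, B, C, D) \<in> mats p"
  defines "x \<equiv> C" and "y \<equiv> -B" and "z \<equiv> C + D - A - B"
  shows "(A + D)^2 = 4 * p + (x + y - z)^2 - 4 * x * y"
    and "(A + D)^2 + (x + y - z) * (x + z - y) + (x + y - z) * (y + z - x) + (x + z - y) * (y + z - x) = 4 * p"
proof -
  have p: "p = A * D - B * C" using assms(1) by (simp add: mats_def)
  show "(A + D)^2 = 4 * p + (x + y - z)^2 - 4 * x * y"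
    unfolding p x_def y_def z_def by (simp add: algebra_simps power2_eq_square)
  show "(A + D)^2 + (x + y - z) * (x + z - y) + (x + y - z) * (y + z - x) + (x + z - y) * (y + z - x) = 4 * p"
    unfolding p x_def y_def z_def by (simp add: algebra_simps power2_eq_square)
qed

lemma tau_form_signs:
  "x > 0 \<Longrightarrow> y < 0 \<Longrightarrow> tau_form x y z t = sgn t"
  "x < 0 \<Longrightarrow> y > 0 \<Longrightarrow> tau_form x y z t = - sgn t"
  "x > 0 \<Longrightarrow> y > 0 \<Longrightarrow> z < 0 \<Longrightarrow> tau_form x y z t = 1"
  "x < 0 \<Longrightarrow> y < 0 \<Longrightarrow> z > 0 \<Longrightarrow> tau_form x y z t = 1"
  using mult_pos_neg[of x y] mult_neg_pos[of x y] mult_pos_pos[of x y] mult_neg_neg[of x y]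
  by (simp_all add: tau_form_def)

text \<open>Of the three cyclic pairs, the one with equal signs gives 1; the two mixed pairs give
  \<open>sgn t\<close> and \<open>- sgn t\<close>, which cancel.\<close>

lemma tau_form_mixed:
  assumes "x \<noteq> 0" "y \<noteq> 0" "z \<noteq> 0" "t \<noteq> 0" "\<not> (x > 0 \<and> y > 0 \<and> z > 0)" "\<not> (x < 0 \<and> y < 0 \<and> z < 0)"
  shows "tau_form x y z t + tau_form z x y t + tau_form y z x t = 1"
  using assms
  by (cases x "0::int" rule: linorder_cases; cases y "0::int" rule: linorder_cases;
      cases z "0::int" rule: linorder_cases) (simp_all add: tau_form_signs)

lemma tau_form_pos:
  assumes "x > 0" "y > 0" "z > 0"
  shows "tau_form x y z t + tau_form z x y t + tau_form y z x t = sgn (x + y - z) + sgn (x + z - y) + sgn (y + z - x)"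
  using assms mult_pos_pos[of x y] mult_pos_pos[of y z] mult_pos_pos[of z x] by (simp add: tau_form_def add.commute)

lemma tau_form_neg:
  assumes "x < 0" "y < 0" "z < 0"
  shows "tau_form x y z t + tau_form z x y t + tau_form y z x t = - (sgn (x + y - z) + sgn (x + z - y) + sgn (y + z - x))"
  using assms mult_neg_neg[of x y] mult_neg_neg[of y z] mult_neg_neg[of z x] by (simp add: tau_form_def add.commute)

lemma tau_form_zero:
  assumes "t \<noteq> 0" "y \<noteq> z"
  shows "tau_form 0 y z t + tau_form z 0 y t + tau_form y z 0 t - 1 =
     (if y * t > 0 \<and> z * t < 0 then -2 else if y = 0 \<or> z = 0 then -1 else 0)"
proof -
  consider "y > 0" "z > 0" | "y > 0" "z < 0" | "y < 0" "z > 0" | "y < 0" "z < 0" | "y = 0" "z \<noteq> 0" | "z = 0" "y \<noteq> 0"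
    using assms(2) by linarith
  then show ?thesis
  proof cases
    case 1
    then show ?thesis using mult_pos_pos[OF 1] by (auto simp: tau_form_def zero_less_mult_iff mult_less_0_iff)
  next
    case 2
    then show ?thesis using mult_pos_neg[OF 2] assms(1) by (auto simp: tau_form_def zero_less_mult_iff mult_less_0_iff sgn_if)
  next
    case 3
    then show ?thesis using mult_neg_pos[OF 3] assms(1) by (auto simp: tau_form_def zero_less_mult_iff mult_less_0_iff sgn_if)
  next
    case 4
    then show ?thesis using mult_neg_neg[OF 4] by (auto simp: tau_form_def zero_less_mult_iff mult_less_0_iff)
  qed (auto simp: tau_form_def)
qed

lemma cyc_tau_mixed:
  assumes M: "(A, B, C, D) \<in> mats p" and p: "p > 0" and nz: "\<not> some_zero (A, B, C, D)"
   and False: "\<not> (C > 0 \<and> B < 0 \<and> C + D - A - B > 0)" "\<not> (C < 0 \<and> B > 0 \<and> C + D - A - B < 0)"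
  shows "cyc tau (A, B, C, D) = 0"
proof -
  define x y z where "x = C" and "y = -B" and "z = C + D - A - B"
  have nz': "x \<noteq> 0" "y \<noteq> 0" "z \<noteq> 0" using nz by (auto simp: x_def y_def z_def)
  have F: "\<not> (x > 0 \<and> y > 0 \<and> z > 0)" "\<not> (x < 0 \<and> y < 0 \<and> z < 0)"
    using False by (auto simp: x_def y_def z_def)
  \<comment> \<open>If the trace were 0, the discriminant identity would make both
    \<open>x * y\<close> and \<open>y * z\<close> positive, so x, y, z would share a sign.\<close>
  have t: "A + D \<noteq> 0"
  proof
    assume t: "A + D = 0"
    have d: "(A + D)^2 = 4 * p + (x + y - z)^2 - 4 * (x * y)"
      using disc_identity(1)[OF M] by (simp add: x_def y_def z_def)
    have d2: "(A + D)^2 = 4 * p + (y + z - x)^2 - 4 * (y * z)"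
      unfolding d by (simp add: algebra_simps power2_eq_square)
    have "x * y > 0" using d t p zero_le_power2[of "x + y - z"] by (simp only: power2_eq_square mult_zero_left)
    moreover have "y * z > 0" using d2 t p zero_le_power2[of "y + z - x"] by (simp only: power2_eq_square mult_zero_left)
    ultimately show False using F by (auto simp: zero_less_mult_iff)
  qed
  show ?thesis
    using tau_form_mixed[OF nz' t F] by (simp add: cyc_tau x_def y_def z_def)
qed

lemma cyc_tau_definite:
  assumes "(C > 0 \<and> B < 0 \<and> C + D - A - B > 0) \<or> (C < 0 \<and> B > 0 \<and> C + D - A - B < 0)"
  shows "cyc tau (A, B, C, D) = sgn C * (sgn (A - D) + sgn (2 * C + D - A) + sgn (D - A - 2 * B)) - 1"
proof -
  have *: "C + - B - (C + D - A - B) = A - D" "C + (C + D - A - B) - - B = 2 * C + D - A"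
    "- B + (C + D - A - B) - C = D - A - 2 * B" by simp_all
  show ?thesis
    using assms unfolding cyc_tau
    using tau_form_pos[of C "-B" "C + D - A - B" "A + D", unfolded *]
      tau_form_neg[of C "-B" "C + D - A - B" "A + D", unfolded *]
    by (elim disjE conjE) simp_all
qed

text \<open>Infinity is fixed, and the other fixed point is \<open>B / (D - A)\<close>. The value is
  -2 if that point lies in (0, 1) and infinity is attracting, and -1 if it is the cusp 0 or
  1.\<close>

lemma cyc_tau_zero:
  assumes M: "(A, B, 0, D) \<in> mats p" and "p > 0" "A \<noteq> D"
  shows "cyc tau (A, B, 0, D) =
     (if B * (A + D) < 0 \<and> (D - A - B) * (A + D) < 0 then -2 else if B = 0 \<or> B = D - A then -1 else 0)"
proof -
  have "A > 0 \<and> D > 0 \<or> A < 0 \<and> D < 0" using assms by (auto simp: mats_def zero_less_mult_iff)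
  then have "A + D \<noteq> 0" by auto
  then show ?thesis
    using assms(3) tau_form_zero[of "A + D" "- B" "D - A - B"] by (auto simp: cyc_tau)
qed

section \<open>Finite support of the triangle weight\<close>

lemma conjU_conjU: "conjU (conjU (A, B, C, D)) = (D - B, A + B - C - D, - B, A + B)"
  by simp

lemma cyc_conjU: "cyc f (conjU M) = cyc f M"
  by (simp add: cyc_def conjU_cube)

lemma fsum_conjU:
  "fsum (mats p) (\<lambda>M. g (conjU M)) = fsum (mats p) g"
  by (rule fsum_bij[OF bij_mats(4)])

text \<open>The pairwise sums of P, Q, R are \<open>2 * x\<close>, \<open>2 * y\<close>,
  \<open>2 * z\<close>, so at most one of P, Q, R is negative, and in that case the signs add up to
  1. Hence all three are nonnegative, and so is every term of the identity; each parameter is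
  bounded because the sum of the other two is at least 2.\<close>

lemma selling_bounds:
  fixes x y z t p :: int
  assumes "x > 0" "y > 0" "z > 0" "p > 0"
    and "sgn (x + y - z) + sgn (x + z - y) + sgn (y + z - x) \<noteq> 1"
    and "t^2 + (x + y - z) * (x + z - y) + (x + y - z) * (y + z - x) + (x + z - y) * (y + z - x) = 4 * p"
  shows "\<bar>t\<bar> \<le> 4 * p" "x \<le> 2 * p" "y \<le> 2 * p" "z \<le> 2 * p"
proof -
  define P Q R where "P = x + y - z" and "Q = x + z - y" and "R = y + z - x"
  have sums: "P + Q = 2 * x" "P + R = 2 * y" "Q + R = 2 * z" by (auto simp: P_def Q_def R_def)
  have eq: "t^2 + P * Q + P * R + Q * R = 4 * p" using assms(6) by (simp add: P_def Q_def R_def)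
  have ne: "sgn P + sgn Q + sgn R \<noteq> 1" using assms(5) by (simp add: P_def Q_def R_def)
  have nonneg: "P \<ge> 0" "Q \<ge> 0" "R \<ge> 0"
    using ne sums assms(1-3) int_sign_cases[of P] int_sign_cases[of Q] int_sign_cases[of R] by linarith+
  have pos: "P * Q \<ge> 0" "P * R \<ge> 0" "Q * R \<ge> 0" using nonneg by simp_all
  have t2: "t^2 \<ge> 0" by simp
  have "\<bar>t\<bar> * 1 \<le> \<bar>t\<bar> * \<bar>t\<bar>" by (cases "t = 0") (auto intro!: mult_left_mono simp del: mult_1_right abs_mult_self_eq)
  then show "\<bar>t\<bar> \<le> 4 * p" using eq pos by (simp add: power2_eq_square)
  have key: "a \<le> 2 * p" if "a * b + a * c \<le> 4 * p" "b + c \<ge> 2" "a \<ge> 0" for a b c :: int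
  proof -
    have "a * 2 \<le> a * (b + c)" by (rule mult_left_mono) (use that in auto)
    then have "a * 2 \<le> a * b + a * c" by (simp only: distrib_left)
    with that(1) show ?thesis by linarith
  qed
  have "P * Q + P * R \<le> 4 * p" using eq pos t2 by linarith
  from key[OF this] have "P \<le> 2 * p" using sums nonneg assms(1-3) by linarith
  moreover have "Q * P + Q * R \<le> 4 * p" using eq pos t2 unfolding mult.commute[of Q P] by linarith
  from key[OF this] have "Q \<le> 2 * p" using sums nonneg assms(1-3) by linarith
  moreover have "R * P + R * Q \<le> 4 * p" using eq pos t2 unfolding mult.commute[of R] by linarith
  from key[OF this] have "R \<le> 2 * p" using sums nonneg assms(1-3) by linarith
  ultimately show "x \<le> 2 * p" "y \<le> 2 * p" "z \<le> 2 * p" using sums by linarith+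
qed

lemma cyc_tau_definite_box:
  assumes M: "(A, B, C, D) \<in> mats p" and p: "p > 0" and ne: "cyc tau (A, B, C, D) \<noteq> 0"
    and def: "(C > 0 \<and> B < 0 \<and> C + D - A - B > 0) \<or> (C < 0 \<and> B > 0 \<and> C + D - A - B < 0)"
  shows "(A, B, C, D) \<in> box (4 * p)"
proof -
  \<comment> \<open>Multiplication by the sign of C makes the three values positive and does not
    change the products in the discriminant identity.\<close>
  define s where "s = sgn C"
  have s: "s = 1 \<or> s = -1" using def by (auto simp: s_def)
  define x y z where "x = s * C" and "y = s * (-B)" and "z = s * (C + D - A - B)"
  have pos: "x > 0" "y > 0" "z > 0" using def by (auto simp: x_def y_def z_def s_def)
  have lin: "x + y - z = s * (A - D)" "x + z - y = s * (2 * C + D - A)" "y + z - x = s * (D - A - 2 * B)"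
    by (simp_all add: x_def y_def z_def algebra_simps)
  have s2: "s * u * (s * v) = u * v" for u v using s by auto
  have "s * sgn u = sgn (s * u)" for u using s by (auto simp: sgn_mult)
  then have "sgn (x + y - z) + sgn (x + z - y) + sgn (y + z - x) \<noteq> 1"
    using ne unfolding cyc_tau_definite[OF def] lin s_def[symmetric] by (simp add: algebra_simps)
  moreover have "(A + D)^2 + (x + y - z) * (x + z - y) + (x + y - z) * (y + z - x) + (x + z - y) * (y + z - x) = 4 * p"
    using disc_identity(2)[OF M] unfolding lin s2 by (simp add: algebra_simps)
  ultimately have b: "\<bar>A + D\<bar> \<le> 4 * p" "x \<le> 2 * p" "y \<le> 2 * p" "z \<le> 2 * p"
    using selling_bounds[OF pos p] by blast+
  have "\<bar>A - D\<bar> = \<bar>x + y - z\<bar>" unfolding lin using s by auto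
  then have "\<bar>A - D\<bar> \<le> 4 * p" using b pos by linarith
  moreover have "\<bar>C\<bar> = x" "\<bar>B\<bar> = y" using pos s unfolding x_def y_def by auto
  ultimately show ?thesis using b unfolding box_def by (simp; linarith)
qed

lemma cyc_tau_zero_box:
  assumes M: "(A, B, 0, D) \<in> mats p" and p: "p > 0" and AD: "A \<noteq> D" and ne: "cyc tau (A, B, 0, D) \<noteq> 0"
  shows "(A, B, 0, D) \<in> box p"
proof -
  have AD: "A * D = p" using M by (simp add: mats_def)
  then have "\<bar>A\<bar> \<le> p" "\<bar>D\<bar> \<le> p" using prod_le_imp_abs_le[of A D p] p by (cases "A = 0"; cases "D = 0"; simp)+
  moreover have "A > 0 \<and> D > 0 \<or> A < 0 \<and> D < 0" using AD p by (auto simp: zero_less_mult_iff)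
  ultimately show ?thesis
    using ne unfolding cyc_tau_zero[OF assms(1-3)] box_def
    by (auto simp: mult_less_0_iff split: if_splits)
qed

lemma conjU_box: "M \<in> box n \<Longrightarrow> conjU M \<in> box (4 * n)"
  by (cases M) (auto simp: box_def)

lemma prime_factor_cases:
  fixes p :: int assumes "prime p" "a * d = p"
  shows "(a, d) \<in> {(1, p), (p, 1), (-1, -p), (-p, -1)}"
proof -
  have "\<bar>a\<bar> dvd p" using assms(2) by auto
  then have "\<bar>a\<bar> = 1 \<or> \<bar>a\<bar> = p" using assms(1) by (auto simp: prime_int_iff)
  moreover have "p > 1" using assms(1) by (simp add: prime_gt_1_int)
  moreover have "p * d = p * 1" if "a = p" using assms(2) that by simp
  moreover have "d = -1" if "a = -p"
  proof -
    have "p * d = p * (-1)" using assms(2) that by simp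
    moreover have "p \<noteq> 0" using \<open>p > 1\<close> by simp
    ultimately show ?thesis by (rule_tac mult_left_cancel[THEN iffD1])
  qed
  moreover have "d = p" if "a = 1" using assms(2) that by simp
  moreover have "d = -p" if "a = -1" using assms(2) that by simp
  moreover from \<open>\<bar>a\<bar> = 1 \<or> \<bar>a\<bar> = p\<close> have "a = 1 \<or> a = -1 \<or> a = p \<or> a = -p" by linarith
  ultimately show ?thesis by (elim disjE) simp_all
qed

text \<open>Otherwise p would be the square of A.\<close>

lemma prime_no_equal_diag:
  assumes "prime p" "(A, B, C, D) \<in> mats p" "B * C = 0" shows "A \<noteq> D"
  using prime_factor_cases[OF assms(1), of A D] assms(2,3) prime_gt_1_int[OF assms(1)]
  by (auto simp: mats_def)

text \<open>Matrices with C = 0 stay in \<open>box p\<close>. The cases B = 0 and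
  \<open>C + D - A - B = 0\<close> are conjugate to this one, and each return by
  \<open>conjU\<close> costs a factor 4; at most two are required, hence 16.\<close>

lemma fin_supp_cyc_tau:
  assumes "prime p" shows "fin_supp (mats p) (cyc tau)"
proof (rule fin_suppI[OF finite_box[of "16 * p"]])
  have p: "p > 0" using assms by (simp add: prime_gt_0_int)
  have Z: "N \<in> box p" if N: "N \<in> mats p" "cyc tau N \<noteq> 0" "fst (snd (snd N)) = 0" for N
  proof -
    obtain A B D where "N = (A, B, 0, D)" using N(3) by (cases N) auto
    then show ?thesis using cyc_tau_zero_box[OF _ p, of A B D] prime_no_equal_diag[OF assms, of A B 0 D] N by simp
  qed
  fix M assume M: "M \<in> mats p" "cyc tau M \<noteq> 0"
  obtain A B C D where Meq: "M = (A, B, C, D)" by (cases M)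
  have mono: "N \<in> box (16 * p)" if "N \<in> box n" "n \<le> 16 * p" for N n using that by (auto simp: box_def)
  consider "C = 0" | "B = 0" | "C + D - A - B = 0"
    | "(C > 0 \<and> B < 0 \<and> C + D - A - B > 0) \<or> (C < 0 \<and> B > 0 \<and> C + D - A - B < 0)"
    using cyc_tau_mixed[of A B C D p] M p unfolding Meq by auto
  then show "M \<in> box (16 * p)"
  proof cases
    case 1
    then show ?thesis using Z[OF M] mono[of _ p] p unfolding Meq by simp
  next
    case 2
    have "conjU (conjU M) \<in> box p"
    proof (rule Z)
      show "conjU (conjU M) \<in> mats p" by (intro mats_closed M)
      show "cyc tau (conjU (conjU M)) \<noteq> 0" using M by (simp add: cyc_conjU del: conjU.simps)
      show "fst (snd (snd (conjU (conjU M)))) = 0" using 2 unfolding Meq conjU_conjU by simp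
    qed
    then have "conjU (conjU (conjU M)) \<in> box (4 * p)" by (rule conjU_box)
    then show ?thesis using mono p by (simp add: conjU_cube)
  next
    case 3
    have "conjU M \<in> box p"
    proof (rule Z)
      show "conjU M \<in> mats p" by (intro mats_closed M)
      show "cyc tau (conjU M) \<noteq> 0" using M by (simp add: cyc_conjU del: conjU.simps)
      show "fst (snd (snd (conjU M))) = 0" using 3 unfolding Meq by simp
    qed
    then have "conjU (conjU (conjU M)) \<in> box (4 * (4 * p))" by (intro conjU_box)
    then show ?thesis by (simp add: conjU_cube)
  next
    case 4
    then show ?thesis using cyc_tau_definite_box[of A B C D p] M p mono[of _ "4 * p"] unfolding Meq by simp
  qed
qed

section \<open>Contribution of the matrices that fix a vertex of the triangle\<close>

lemma fsum_split_some_zero: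
  assumes p: "prime p"
  shows "fsum (mats p) (\<lambda>M. of_bool (some_zero M) * cyc tau M) =
     3 * fsum (mats p) (\<lambda>M. of_bool (fst (snd (snd M)) = 0 \<and> fst (snd M) \<noteq> 0) * cyc tau M)"
proof -
  \<comment> \<open>The condition on B makes the selection half open: also a matrix for which two of
    the three cyclically permuted values vanish is selected by exactly one of its
    conjugates.\<close>
  let ?z = "\<lambda>M :: mat2. of_bool (fst (snd (snd M)) = 0 \<and> fst (snd M) \<noteq> 0) :: int"
  let ?f = "\<lambda>M. ?z M * cyc tau M"
  have fin: "fin_supp (mats p) ?f" by (intro fin_supp_mult fin_supp_cyc_tau p)
  have fin1: "fin_supp (mats p) (\<lambda>M. ?f (conjU M))"
    using fin_supp_bij[OF bij_mats(4), of p ?f] fin by simp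
  have fin2: "fin_supp (mats p) (\<lambda>M. ?f (conjU (conjU M)))"
    using fin_supp_bij[OF bij_mats(4), of p "\<lambda>M. ?f (conjU M)"] fin1 by simp
  have s1: "fsum (mats p) (\<lambda>M. ?f (conjU M)) = fsum (mats p) ?f" by (rule fsum_conjU)
  have s2: "fsum (mats p) (\<lambda>M. ?f (conjU (conjU M))) = fsum (mats p) ?f"
    using fsum_conjU[of p "\<lambda>M. ?f (conjU M)"] s1 by simp
  have "fsum (mats p) (\<lambda>M. of_bool (some_zero M) * cyc tau M) =
     fsum (mats p) (\<lambda>M. ?f M + ?f (conjU M) + ?f (conjU (conjU M)))"
  proof (rule fsum_cong)
    fix M assume M: "M \<in> mats p"
    obtain A B C D where Meq: "M = (A, B, C, D)" by (cases M)
    have "\<not> (B = 0 \<and> C = 0 \<and> C + D - A - B = 0)"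
      using prime_no_equal_diag[OF p, of A B C D] M unfolding Meq by auto
    then have "of_bool (some_zero M) = ?z M + ?z (conjU M) + ?z (conjU (conjU M))"
      unfolding Meq conjU_conjU by (cases "B = 0"; cases "C = 0"; cases "C + D - A - B = 0"; simp)
    then show "of_bool (some_zero M) * cyc tau M = ?f M + ?f (conjU M) + ?f (conjU (conjU M))"
      unfolding cyc_conjU by (simp only: distrib_right)
  qed
  also have "\<dots> = 3 * fsum (mats p) ?f"
    by (simp only: fsum_add[OF fin_supp_add[OF fin fin1] fin2] fsum_add[OF fin fin1] s1 s2)
  finally show ?thesis .
qed

lemma fsum_triangular:
  assumes p: "prime p"
  shows "fsum (mats p) (\<lambda>M. of_bool (fst (snd (snd M)) = 0 \<and> fst (snd M) \<noteq> 0) * cyc tau M) = -4 * (p - 1)"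
proof -
  let ?f = "\<lambda>M :: mat2. of_bool (fst (snd (snd M)) = 0 \<and> fst (snd M) \<noteq> 0) * cyc tau M"
  have p1: "p > 1" using p by (simp add: prime_gt_1_int)
  \<comment> \<open>On \<open>Y1\<close> and \<open>Y2\<close> infinity is attracting and the other
    fixed point lies in (0, 1]. It equals 1 for b = 1 - p, which lowers the contribution from -2 to
    -1 in absolute value. On \<open>Y3\<close> infinity is repelling and the other fixed point is
    1.\<close>
  define Y1 :: "mat2 set" where "Y1 = (\<lambda>b. (p, b, 0, 1)) ` {1-p..-1}"
  define Y2 :: "mat2 set" where "Y2 = (\<lambda>b. (-p, -b, 0, -1)) ` {1-p..-1}"
  define Y3 :: "mat2 set" where "Y3 = {(1, p - 1, 0, p), (-1, 1 - p, 0, -p)}"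
  have val: "cyc tau (a, b, 0, d) = (if b * (a + d) < 0 \<and> (d - a - b) * (a + d) < 0 then -2 else if b = 0 \<or> b = d - a then -1 else 0)"
    if "(a, d) \<in> {(1, p), (p, 1), (-1, -p), (-p, -1)}" for a b d
    using that p1 by (intro cyc_tau_zero[of _ _ _ p]) (auto simp: mats_def)
  have "fsum (mats p) ?f = sum ?f (Y1 \<union> Y2 \<union> Y3)"
  proof (rule fsum_eq_sum)
    fix M assume M: "M \<in> mats p" "?f M \<noteq> 0"
    then obtain a b d where Meq: "M = (a, b, 0, d)" "b \<noteq> 0" by (cases M) (auto split: if_splits)
    with M have ad: "(a, d) \<in> {(1, p), (p, 1), (-1, -p), (-p, -1)}"
      by (intro prime_factor_cases p) (simp add: mats_def)
    have "cyc tau (a, b, 0, d) \<noteq> 0" using M Meq by auto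
    then have v: "b * (a + d) < 0 \<and> (d - a - b) * (a + d) < 0 \<or> b = d - a"
      unfolding val[OF ad] using Meq(2) by (auto split: if_splits)
    consider "a = 1" "d = p" | "a = p" "d = 1" | "a = -1" "d = -p" | "a = -p" "d = -1" using ad by auto
    then show "M \<in> Y1 \<union> Y2 \<union> Y3"
    proof cases
      case 1
      with v p1 show ?thesis unfolding Meq(1) Y3_def by (auto simp: mult_less_0_iff)
    next
      case 2
      with v p1 Meq(2) have "b \<in> {1-p..-1}" by (auto simp: mult_less_0_iff)
      then show ?thesis unfolding Meq(1) Y1_def using 2 by auto
    next
      case 3
      with v p1 show ?thesis unfolding Meq(1) Y3_def by (auto simp: mult_less_0_iff)
    next
      case 4
      with v p1 Meq(2) have "-b \<in> {1-p..-1}" by (auto simp: mult_less_0_iff)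
      then show ?thesis unfolding Meq(1) Y2_def using 4 by (auto intro!: image_eqI[of _ _ "-b"])
    qed
  next
    show "finite (Y1 \<union> Y2 \<union> Y3)" by (simp add: Y1_def Y2_def Y3_def)
    show "Y1 \<union> Y2 \<union> Y3 \<subseteq> mats p" unfolding Y1_def Y2_def Y3_def mats_def by fastforce
  qed
  also have "\<dots> = sum ?f Y1 + sum ?f Y2 + sum ?f Y3"
  proof -
    have "fst ` Y1 \<subseteq> {p}" "fst ` Y2 \<subseteq> {-p}" "fst ` Y3 \<subseteq> {1, -1}" by (auto simp: Y1_def Y2_def Y3_def)
    moreover have disj: "X \<inter> Y = {}" if "fst ` X \<subseteq> P" "fst ` Y \<subseteq> Q" "P \<inter> Q = {}"
      for X Y :: "mat2 set" and P Q using that by blast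
    ultimately have "Y1 \<inter> Y2 = {}" "Y1 \<inter> Y3 = {}" "Y2 \<inter> Y3 = {}"
      using disj[of Y1 "{p}" Y2 "{-p}"] disj[of Y1 "{p}" Y3 "{1,-1}"] disj[of Y2 "{-p}" Y3 "{1,-1}"] p1 by simp_all
    moreover have "finite Y1" "finite Y2" "finite Y3" by (simp_all add: Y1_def Y2_def Y3_def)
    ultimately have "sum g (Y1 \<union> Y2 \<union> Y3) = sum g Y1 + sum g Y2 + sum g Y3" for g :: "mat2 \<Rightarrow> int"
      by (simp add: sum.union_disjoint Int_Un_distrib2)
    then show ?thesis .
  qed
  also have "sum ?f Y3 = -2"
  proof -
    have "cyc tau (1, p - 1, 0, p) = -1" using p1 val[of 1 p "p - 1"] by (simp add: mult_less_0_iff)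
    moreover have "cyc tau (-1, 1 - p, 0, -p) = -1" using p1 val[of "-1" "-p" "1 - p"] by (simp add: mult_less_0_iff)
    ultimately show ?thesis using p1 by (simp add: Y3_def)
  qed
  also have "sum ?f Y1 = (\<Sum>b\<in>{1-p..-1}. ?f (p, b, 0, 1))"
    unfolding Y1_def by (subst sum.reindex) (auto simp: inj_on_def)
  also have "\<dots> = (\<Sum>b\<in>{1-p..-1}. -2 + of_bool (b = 1 - p))"
  proof (rule sum.cong)
    fix b assume "b \<in> {1-p..-1}"
    then show "?f (p, b, 0, 1) = -2 + of_bool (b = 1 - p)"
      using p1 val[of p 1 b] by (auto simp: mult_less_0_iff)
  qed simp
  also have "sum ?f Y2 = (\<Sum>b\<in>{1-p..-1}. ?f (-p, -b, 0, -1))"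
    unfolding Y2_def by (subst sum.reindex) (auto simp: inj_on_def)
  also have "\<dots> = (\<Sum>b\<in>{1-p..-1}. -2 + of_bool (b = 1 - p))"
  proof (rule sum.cong)
    fix b assume "b \<in> {1-p..-1}"
    then show "?f (-p, -b, 0, -1) = -2 + of_bool (b = 1 - p)"
      using p1 val[of "-p" "-1" "-b"] by (auto simp: mult_less_0_iff zero_less_mult_iff)
  qed simp
  also have "(\<Sum>b\<in>{1-p..-1}. -2 + of_bool (b = 1 - p)) = -2 * (p - 1) + 1"
    unfolding sum.distrib of_bool_def using p1 by (simp add: sum.delta)
  finally show ?thesis by simp
qed

subsection \<open>The count over all traces\<close>

text \<open>The two terms describe the image of infinity being infinity and that of 0 lying in [0, 1], respectively the image of 0
  being infinity and that of infinity lying in (0, 1). These are the ties that survive averaging over left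
  multiplication by U.\<close>
definition tie_count :: "mat2 \<Rightarrow> int" where
  "tie_count M = (case M of (A, B, C, D) \<Rightarrow> of_bool (C = 0 \<and> B * D \<ge> 0 \<and> D * (D - B) \<ge> 0)
     + of_bool (D = 0 \<and> A * C > 0 \<and> C * (C - A) > 0))"

definition left_orbit :: "(mat2 \<Rightarrow> int) \<Rightarrow> mat2 \<Rightarrow> int" where
  "left_orbit f M = f M + f (leftU M) + f (leftU (leftU M))"

lemma int_sgn_minus: "sgn (- x :: int) = - sgn x"
  by (simp add: sgn_if)

text \<open>The position of the point a/c relative to the three edges of the ideal triangle.\<close>
lemma arc_cases:
  fixes a c :: int assumes "a \<noteq> 0 \<or> c \<noteq> 0"
  shows "(sgn (a * c), sgn (c * (c - a)), sgn (a * (a - c))) \<in>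
     {(0, 1, 0), (0, 0, 1), (1, 0, 0), (-1, 1, 1), (1, 1, -1), (1, -1, 1)}"
  using assms
  by (cases a "0::int" rule: linorder_cases; cases c "0::int" rule: linorder_cases;
      cases a c rule: linorder_cases) (simp_all add: sgn_mult)

lemma tie_count_sgn:
  assumes "(A, B, C, D) \<in> mats p" "p > 0"
  shows "tie_count (A, B, C, D) =
     of_bool ((sgn (A * C) = 0 \<and> sgn (C * (C - A)) = 0) \<and> sgn (B * D) \<ge> 0 \<and> sgn (D * (D - B)) \<ge> 0) +
     of_bool ((sgn (B * D) = 0 \<and> sgn (D * (D - B)) = 0) \<and> sgn (A * C) > 0 \<and> sgn (C * (C - A)) > 0)"
proof -
  have "sgn (A * C) = 0 \<and> sgn (C * (C - A)) = 0 \<longleftrightarrow> C = 0" "sgn (B * D) = 0 \<and> sgn (D * (D - B)) = 0 \<longleftrightarrow> D = 0"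
    using assms by (auto simp: mats_def sgn_0_0)
  moreover have "sgn x \<ge> 0 \<longleftrightarrow> x \<ge> 0" "sgn x > 0 \<longleftrightarrow> x > 0" for x :: int
    by (auto simp: sgn_if)
  ultimately show ?thesis unfolding tie_count_def prod.case by (simp only:)
qed

text \<open>Left multiplication by U cycles the edges, so only the arcs containing the images
  \<open>A / C\<close> and \<open>B / D\<close> matter. By \<open>arc_cases\<close> this leaves a
  finite check; the two images cannot be the same vertex because the determinant is not 0.\<close>

lemma left_orbit_eta:
  assumes M: "M \<in> mats p" and p: "p > 0"
  shows "left_orbit eta M - 1 = left_orbit tie_count M"
proof -
  obtain A B C D where Meq: "M = (A, B, C, D)" by (cases M)
  have L: "leftU M = (-C, -D, A - C, B - D)" "leftU (leftU M) = (C - A, D - B, - A, - B)"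
    by (simp_all add: Meq)
  define e0 e1 e2 where "e0 = sgn (A * C)" and "e1 = sgn (C * (C - A))" and "e2 = sgn (A * (A - C))"
  define f0 f1 f2 where "f0 = sgn (B * D)" and "f1 = sgn (D * (D - B))" and "f2 = sgn (B * (B - D))"
  have e: "(e0, e1, e2) \<in> {(0, 1, 0), (0, 0, 1), (1, 0, 0), (-1, 1, 1), (1, 1, -1), (1, -1, 1)}"
    unfolding e0_def e1_def e2_def using M p by (intro arc_cases) (auto simp: Meq mats_def)
  have f: "(f0, f1, f2) \<in> {(0, 1, 0), (0, 0, 1), (1, 0, 0), (-1, 1, 1), (1, 1, -1), (1, -1, 1)}"
    unfolding f0_def f1_def f2_def using M p by (intro arc_cases) (auto simp: Meq mats_def)
  have ne: "\<not> (e0 = 0 \<and> e1 = 0 \<and> f0 = 0 \<and> f1 = 0)" "\<not> (e1 = 0 \<and> e2 = 0 \<and> f1 = 0 \<and> f2 = 0)"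
    "\<not> (e2 = 0 \<and> e0 = 0 \<and> f2 = 0 \<and> f0 = 0)"
    using M p by (auto simp: e0_def e1_def e2_def f0_def f1_def f2_def Meq mats_def sgn_0_0)
  have sg: "sgn (- C * (A - C)) = e1" "sgn ((C - A) * - A) = e2" "sgn (- D * (B - D)) = f1" "sgn ((D - B) * - B) = f2"
    "sgn ((A - C) * (A - C - - C)) = e2" "sgn ((B - D) * (B - D - - D)) = f2"
    "sgn (- A * (- A - (C - A))) = e0" "sgn (- B * (- B - (D - B))) = f0"
    unfolding e0_def e1_def e2_def f0_def f1_def f2_def by (simp_all add: algebra_simps)
  have m: "leftU M \<in> mats p" "leftU (leftU M) \<in> mats p" using M by (simp_all add: mats_closed)
  have eta: "eta M = sgn (e0 + f0)" by (simp add: Meq e0_def f0_def)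
  have eta1: "eta (leftU M) = sgn (e1 + f1)" unfolding L(1) eta.simps sg ..
  have eta2: "eta (leftU (leftU M)) = sgn (e2 + f2)" unfolding L(2) eta.simps sg ..
  have tie_count: "tie_count M = of_bool ((e0 = 0 \<and> e1 = 0) \<and> f0 \<ge> 0 \<and> f1 \<ge> 0) + of_bool ((f0 = 0 \<and> f1 = 0) \<and> e0 > 0 \<and> e1 > 0)"
    using tie_count_sgn[of A B C D p] M p unfolding Meq e0_def e1_def f0_def f1_def by simp
  have tie1: "tie_count (leftU M) = of_bool ((e1 = 0 \<and> e2 = 0) \<and> f1 \<ge> 0 \<and> f2 \<ge> 0) + of_bool ((f1 = 0 \<and> f2 = 0) \<and> e1 > 0 \<and> e2 > 0)"
    unfolding L(1) using tie_count_sgn[OF m(1)[unfolded L(1)] p] unfolding sg .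
  have tie2: "tie_count (leftU (leftU M)) = of_bool ((e2 = 0 \<and> e0 = 0) \<and> f2 \<ge> 0 \<and> f0 \<ge> 0) + of_bool ((f2 = 0 \<and> f0 = 0) \<and> e2 > 0 \<and> e0 > 0)"
    unfolding L(2) using tie_count_sgn[OF m(2)[unfolded L(2)] p] unfolding sg .
  show ?thesis
    unfolding left_orbit_def eta eta1 eta2 tie_count tie1 tie2 using e f ne
    by (simp only: insert_iff empty_iff simp_thms prod.inject) (elim disjE conjE; simp)
qed

text \<open>If C = 0, the diagonal is (p, 1) or (1, p) up to sign, with 2 or p + 1 choices for B. If
  D = 0, then \<open>A / C\<close> lies strictly between 0 and 1, which forces
  \<open>\<bar>C\<bar> = p\<close> and leaves p - 1 choices. The global sign doubles the
  count.\<close>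

lemma
  assumes p: "prime p"
  shows fin_supp_tie_count: "fin_supp (mats p) tie_count" and fsum_tie_count: "fsum (mats p) tie_count = 4 * (p + 1)"
proof -
  have p1: "p > 1" using p by (simp add: prime_gt_1_int)
  define f1 f2 f3 :: "int \<times> int \<Rightarrow> mat2"
    where "f1 = (\<lambda>(s, b). (s * p, s * b, 0, s))" and "f2 = (\<lambda>(s, b). (s, s * b, 0, s * p))"
      and "f3 = (\<lambda>(s, a). (s * a, - s, s * p, 0))"
  define Z1 Z2 Z3 :: "(int \<times> int) set"
    where "Z1 = {1, -1} \<times> {0, 1}" and "Z2 = {1, -1} \<times> {0..p}" and "Z3 = {1, -1} \<times> {1..p-1}"
  let ?Y = "f1 ` Z1 \<union> f2 ` Z2 \<union> f3 ` Z3"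
  have fin: "finite ?Y" by (simp add: Z1_def Z2_def Z3_def)
  have sub: "?Y \<subseteq> mats p" by (auto simp: f1_def f2_def f3_def Z1_def Z2_def Z3_def mats_def)
  have supp: "M \<in> ?Y" if M: "M \<in> mats p" "tie_count M \<noteq> 0" for M
  proof -
    obtain A B C D where Meq: "M = (A, B, C, D)" by (cases M)
    consider "C = 0" "B * D \<ge> 0" "D * (D - B) \<ge> 0" | "D = 0" "A * C > 0" "C * (C - A) > 0"
      using M(2) by (auto simp: Meq tie_count_def of_bool_def split: if_splits)
    then show ?thesis
    proof cases
      case 1
      then have "(A, D) \<in> {(1, p), (p, 1), (-1, -p), (-p, -1)}"
        using M(1) by (intro prime_factor_cases p) (simp add: Meq mats_def)
      then consider "A = 1" "D = p" | "A = p" "D = 1" | "A = -1" "D = -p" | "A = -p" "D = -1" by auto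
      then show ?thesis
      proof cases
        case a: 1
        then have "(1, B) \<in> Z2" using 1 p1 by (auto simp: Z2_def zero_le_mult_iff)
        then have "f2 (1, B) \<in> ?Y" by blast
        then show ?thesis using a 1 by (simp add: f2_def Meq)
      next
        case a: 2
        then have "(1, B) \<in> Z1" using 1 p1 by (auto simp: Z1_def)
        then have "f1 (1, B) \<in> ?Y" by blast
        then show ?thesis using a 1 by (simp add: f1_def Meq)
      next
        case a: 3
        then have "(-1, -B) \<in> Z2" using 1 p1 by (auto simp: Z2_def mult_le_0_iff zero_le_mult_iff)
        then have "f2 (-1, -B) \<in> ?Y" by blast
        then show ?thesis using a 1 by (simp add: f2_def Meq)
      next
        case a: 4
        then have "(-1, -B) \<in> Z1" using 1 p1 by (auto simp: Z1_def)
        then have "f1 (-1, -B) \<in> ?Y" by blast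
        then show ?thesis using a 1 by (simp add: f1_def Meq)
      qed
    next
      case 2
      then have "(C, -B) \<in> {(1, p), (p, 1), (-1, -p), (-p, -1)}"
        using M(1) by (intro prime_factor_cases p) (simp add: Meq mats_def mult.commute)
      then consider "C = 1" | "C = p" "B = -1" | "C = -1" | "C = -p" "B = 1" by auto
      then show ?thesis
      proof cases
        case a: 2
        then have "(1, A) \<in> Z3" using 2 p1 by (auto simp: Z3_def zero_less_mult_iff)
        then have "f3 (1, A) \<in> ?Y" by blast
        then show ?thesis using a 2 by (simp add: f3_def Meq)
      next
        case a: 4
        then have "(-1, -A) \<in> Z3" using 2 p1 by (auto simp: Z3_def mult_less_0_iff zero_less_mult_iff)
        then have "f3 (-1, -A) \<in> ?Y" by blast
        then show ?thesis using a 2 by (simp add: f3_def Meq)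
      qed (use 2 in auto)
    qed
  qed
  show "fin_supp (mats p) tie_count" by (rule fin_suppI[OF fin supp])
  have "tie_count M = 1" if "M \<in> ?Y" for M
    using that
  proof (elim UnE imageE)
    fix x assume "M = f1 x" "x \<in> Z1" then show ?thesis using p1 by (auto simp: f1_def Z1_def tie_count_def)
  next
    fix x assume "M = f2 x" "x \<in> Z2" then show ?thesis using p1 by (auto simp: f2_def Z2_def tie_count_def zero_le_mult_iff mult_le_0_iff)
  next
    fix x assume "M = f3 x" "x \<in> Z3" then show ?thesis using p1 by (auto simp: f3_def Z3_def tie_count_def zero_less_mult_iff mult_less_0_iff)
  qed
  then have "fsum (mats p) tie_count = int (card ?Y)"
    by (subst fsum_eq_sum[OF fin sub supp]) simp_all
  also have "card ?Y = card (f1 ` Z1) + card (f2 ` Z2) + card (f3 ` Z3)"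
  proof -
    have im: "(\<lambda>M. (\<bar>fst M\<bar>, fst (snd (snd M)))) ` f1 ` Z1 \<subseteq> {p} \<times> {0}" "(\<lambda>M. (\<bar>fst M\<bar>, fst (snd (snd M)))) ` f2 ` Z2 \<subseteq> {1} \<times> {0}"
       "(\<lambda>M. (\<bar>fst M\<bar>, fst (snd (snd M)))) ` f3 ` Z3 \<subseteq> UNIV \<times> {p, -p}"
      using p1 by (auto simp: f1_def f2_def f3_def Z1_def Z2_def Z3_def)
    have disj: "X \<inter> Y = {}" if "h ` X \<subseteq> P" "h ` Y \<subseteq> Q" "P \<inter> Q = {}"
      for X Y :: "mat2 set" and P Q :: "(int \<times> int) set" and h using that by blast
    have "f1 ` Z1 \<inter> f2 ` Z2 = {}" by (rule disj[OF im(1,2)]) (use p1 in auto)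
    moreover have "f1 ` Z1 \<inter> f3 ` Z3 = {}" by (rule disj[OF im(1,3)]) (use p1 in auto)
    moreover have "f2 ` Z2 \<inter> f3 ` Z3 = {}" by (rule disj[OF im(2,3)]) (use p1 in auto)
    ultimately show ?thesis
      using fin by (simp add: card_Un_disjoint Int_Un_distrib2)
  qed
  also have "card (f1 ` Z1) = card Z1"
    using p1 by (intro card_image) (auto simp: inj_on_def f1_def Z1_def)
  also have "card (f2 ` Z2) = card Z2"
    using p1 by (intro card_image) (auto simp: inj_on_def f2_def Z2_def)
  also have "card (f3 ` Z3) = card Z3"
    using p1 by (intro card_image) (auto simp: inj_on_def f3_def Z3_def)
  finally show "fsum (mats p) tie_count = 4 * (p + 1)"
    using p1 by (simp add: Z1_def Z2_def Z3_def card_cartesian_product)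
qed

section \<open>Evaluation of the total weight\<close>

lemma fsum_orbit:
  assumes "bij_betw h (mats p) (mats p)" "fin_supp (mats p) f"
  shows "fin_supp (mats p) (\<lambda>M. f M + f (h M) + f (h (h M)))"
    "fsum (mats p) (\<lambda>M. f M + f (h M) + f (h (h M))) = 3 * fsum (mats p) f"
proof -
  have fin: "fin_supp (mats p) (\<lambda>M. f (h M))" "fin_supp (mats p) (\<lambda>M. f (h (h M)))"
    using fin_supp_bij[OF assms(1), of f] fin_supp_bij[OF assms(1), of "\<lambda>M. f (h M)"] assms(2) by simp_all
  then show "fin_supp (mats p) (\<lambda>M. f M + f (h M) + f (h (h M)))"
    using assms(2) by (intro fin_supp_add)
  have "fsum (mats p) (\<lambda>M. f (h M)) = fsum (mats p) f" "fsum (mats p) (\<lambda>M. f (h (h M))) = fsum (mats p) f"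
    using fsum_bij[OF assms(1), of f] fsum_bij[OF assms(1), of "\<lambda>M. f (h M)"] by simp_all
  then show "fsum (mats p) (\<lambda>M. f M + f (h M) + f (h (h M))) = 3 * fsum (mats p) f"
    by (simp only: fsum_add[OF fin_supp_add[OF assms(2) fin(1)] fin(2)] fsum_add[OF assms(2) fin(1)])
qed

lemma fsum_conjS_odd:
  assumes "\<And>M. M \<in> mats p \<Longrightarrow> f (conjS M) = - f M"
  shows "fsum (mats p) f = 0"
  using fsum_bij[OF bij_mats(5), of p f] fsum_cong[of "mats p" "\<lambda>M. f (conjS M)" "\<lambda>M. - f M"] assms
  by (simp add: fsum_uminus)

lemma eta_conjS: "eta (conjS M) = - eta M"
proof (cases M)
  case (fields A B C D)
  have "sgn (D * - B) + sgn (- C * A) = - (sgn (A * C) + sgn (B * D))" by (simp add: sgn_mult)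
  then show ?thesis unfolding fields by (simp only: conjS.simps eta.simps int_sgn_minus)
qed

lemma cyc_diff: "cyc f M - cyc g M = (f M - g M) + (f (conjU M) - g (conjU M)) + (f (conjU (conjU M)) - g (conjU (conjU M)))"
  by (simp add: cyc_def)

text \<open>Both sides add f over the nine matrices U^i M U^j and subtract 3, since
  \<open>conjU\<close> is left multiplication by U combined with right multiplication by
  U^2.\<close>

lemma sum_cyc_leftU:
  "cyc f M + cyc f (leftU M) + cyc f (leftU (leftU M)) =
   (left_orbit f M - 1) + (left_orbit f (rightU M) - 1) + (left_orbit f (rightU (rightU M)) - 1)"
  unfolding cyc_def left_orbit_def conjU_eq by (simp add: leftU_rightU leftU_cube rightU_cube)

text \<open>The difference of \<open>tau\<close> and \<open>eta\<close> is odd under conjugation by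
  S, so it sums to 0. Averaging \<open>cyc eta\<close> over left multiplication by U leaves nothing
  but ties.\<close>

lemma fsum_cyc_tau:
  assumes p: "prime p" shows "fsum (mats p) (cyc tau) = 12 * (p + 1)"
proof -
  have p0: "p > 0" using p by (simp add: prime_gt_0_int)
  let ?d = "\<lambda>M. tau M - eta M"
  note d = fsum_orbit[OF bij_mats(4) fin_supp_tau_eta[OF p0]]
  \<comment> \<open>\<open>eta\<close> itself has infinite support; the finiteness for
    \<open>cyc eta\<close> is inherited from \<open>cyc tau\<close> through the finitely supported
    difference.\<close>
  have fe: "fin_supp (mats p) (cyc eta)"
    using fin_supp_diff[OF fin_supp_cyc_tau[OF p] d(1)] by (simp add: cyc_diff[symmetric] del: eta.simps tau.simps)
  have "fsum (mats p) ?d = 0" by (rule fsum_conjS_odd) (simp add: tau_conjS eta_conjS)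
  then have "fsum (mats p) (cyc tau) - fsum (mats p) (cyc eta) = 0"
    using d(2) unfolding fsum_diff[OF fin_supp_cyc_tau[OF p] fe, symmetric] cyc_diff by simp
  moreover have "3 * fsum (mats p) (cyc eta) = 9 * fsum (mats p) tie_count"
  proof -
    note k = fsum_orbit[OF bij_mats(1) fin_supp_tie_count[OF p], folded left_orbit_def]
    note r = fsum_orbit[OF bij_mats(2) k(1)]
    have "3 * fsum (mats p) (cyc eta) = fsum (mats p) (\<lambda>M. cyc eta M + cyc eta (leftU M) + cyc eta (leftU (leftU M)))"
      by (rule fsum_orbit(2)[OF bij_mats(1) fe, symmetric])
    also have "\<dots> = fsum (mats p) (\<lambda>M. left_orbit tie_count M + left_orbit tie_count (rightU M) + left_orbit tie_count (rightU (rightU M)))"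
      unfolding sum_cyc_leftU by (rule fsum_cong) (simp add: left_orbit_eta[OF _ p0] mats_closed)
    also have "\<dots> = 9 * fsum (mats p) tie_count" unfolding r k by simp
    finally show ?thesis .
  qed
  ultimately show ?thesis unfolding fsum_tie_count[OF p] by simp
qed

subsection \<open>The quaternion subgroup modulo 3\<close>

lemma box_if_both_smaller:
  fixes x y z w p :: int
  assumes "x > 0" "y > 0" "z > 0" "w > 0" "x * w - y * z = p" "y < x" "z < w"
  shows "x \<le> p" "y \<le> p" "z \<le> p" "w \<le> p"
proof -
  \<comment> \<open>The bounds come from writing p as \<open>(x - y) * w + y * (w - z)\<close> and
    as \<open>x * (w - z) + z * (x - y)\<close>, where both differences are at least 1.\<close>
  have "y * z + y \<le> y * w" using mult_left_mono[of "z + 1" w y] assms by (simp add: algebra_simps)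
  then have "(x - y) * w \<le> p - y" using assms(5) by (simp add: algebra_simps)
  moreover have "1 * w \<le> (x - y) * w" using assms by (intro mult_right_mono) auto
  ultimately have w: "w \<le> p - y" by linarith
  have "y * z + z \<le> x * z" using mult_right_mono[of "y + 1" x z] assms by (simp add: algebra_simps)
  then have "x * (w - z) \<le> p - z" using assms(5) by (simp add: algebra_simps)
  moreover have "x * 1 \<le> x * (w - z)" using assms by (intro mult_left_mono) auto
  ultimately have x: "x \<le> p - z" by linarith
  show "x \<le> p" "y \<le> p" "z \<le> p" "w \<le> p" using x w assms by linarith+
qed

text \<open>Images of two cusps on different sides of the imaginary axis would bound all entries in
  terms of the determinant. So outside the box the sign of an image of 0, 1 or infinity, under the
  stated nonvanishing, is that of the fixed point.\<close>

lemma tau_outside_box: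
  assumes M: "(A, B, C, D) \<in> mats p" and p: "p > 0" and box: "(A, B, C, D) \<notin> box p"
  shows "A * C \<noteq> 0 \<Longrightarrow> tau (A, B, C, D) = sgn (A * C)"
    and "B * D \<noteq> 0 \<Longrightarrow> tau (A, B, C, D) = sgn (B * D)"
    and "A * C = 0 \<or> B * D = 0 \<or> A + B \<noteq> 0 \<and> C + D \<noteq> 0 \<Longrightarrow>
       tau (A, B, C, D) = sgn ((A + B) * (C + D))"
    and "A * C \<noteq> 0 \<or> B * D \<noteq> 0"
proof -
  have det: "A * D - B * C = p" using M by (simp add: mats_def)
  have opp: "\<not> (A * D > 0 \<and> B * C < 0)" using box_if_opposite[OF M] box by auto
  have teta: "tau (A, B, C, D) = sgn (sgn (A * C) + sgn (B * D))"
    unfolding tau_eq_eta[OF M p opp] by simp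
  have zA: "\<bar>B\<bar> \<le> p \<and> \<bar>C\<bar> \<le> p \<and> B \<noteq> 0 \<and> C \<noteq> 0" if "A * D = 0"
    using prod_le_imp_abs_le[of B C p] det that p by (cases "B = 0"; cases "C = 0"; simp)
  have zB: "\<bar>A\<bar> \<le> p \<and> \<bar>D\<bar> \<le> p \<and> A \<noteq> 0 \<and> D \<noteq> 0" if "B * C = 0"
    using prod_le_imp_abs_le[of A D p] det that p by (cases "A = 0"; cases "D = 0"; simp)
  have nb: "\<bar>A\<bar> > p \<or> \<bar>B\<bar> > p \<or> \<bar>C\<bar> > p \<or> \<bar>D\<bar> > p"
    using box by (auto simp: box_def)
  show nz: "A * C \<noteq> 0 \<or> B * D \<noteq> 0" using zA zB nb by fastforce
  have eq: "sgn (A * C) = sgn (B * D)" if "A * C \<noteq> 0" "B * D \<noteq> 0"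
  proof -
    have "A * D > 0 \<and> B * C > 0 \<or> A * D < 0 \<and> B * C < 0"
      using opp det p that by (cases "A * D" "0 :: int" rule: linorder_cases; cases "B * C" "0 :: int" rule: linorder_cases; simp)
    then show ?thesis
      by (auto simp: sgn_mult zero_less_mult_iff mult_less_0_iff)
  qed
  have ss: "sgn (sgn x + sgn x) = sgn x" "sgn (sgn x) = sgn x" for x :: int by (auto simp: sgn_if)
  show c1: "tau (A, B, C, D) = sgn (A * C)" if "A * C \<noteq> 0"
    unfolding teta using eq[OF that] ss by (cases "B * D = 0") auto
  show c2: "tau (A, B, C, D) = sgn (B * D)" if "B * D \<noteq> 0"
    unfolding teta using eq that ss by (cases "A * C = 0") auto
  show "tau (A, B, C, D) = sgn ((A + B) * (C + D))" if h: "A * C = 0 \<or> B * D = 0 \<or> A + B \<noteq> 0 \<and> C + D \<noteq> 0"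
  proof -
    \<comment> \<open>If one entry is 0, its two neighbours are at most p in absolute value, so the
      opposite entry exceeds p and dominates its neighbours.\<close>
    consider "A = 0" | "B = 0" | "C = 0" | "D = 0" | "A * C \<noteq> 0" "B * D \<noteq> 0" "A + B \<noteq> 0" "C + D \<noteq> 0"
      using h by auto
    then show ?thesis
    proof cases
      case 1
      then have "\<bar>D\<bar> > \<bar>C\<bar>" using zA nb p by fastforce
      then have "sgn (C + D) = sgn D" by (auto simp: sgn_if)
      then show ?thesis using c2 zA 1 \<open>\<bar>D\<bar> > \<bar>C\<bar>\<close> by (auto simp: sgn_mult)
    next
      case 2
      then have "\<bar>C\<bar> > \<bar>D\<bar>" using zB nb p by fastforce
      then have "sgn (C + D) = sgn C" by (auto simp: sgn_if)
      then show ?thesis using c1 zB 2 \<open>\<bar>C\<bar> > \<bar>D\<bar>\<close> by (auto simp: sgn_mult)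
    next
      case 3
      then have "\<bar>B\<bar> > \<bar>A\<bar>" using zB nb p by fastforce
      then have "sgn (A + B) = sgn B" by (auto simp: sgn_if)
      then show ?thesis using c2 zB 3 \<open>\<bar>B\<bar> > \<bar>A\<bar>\<close> by (auto simp: sgn_mult)
    next
      case 4
      then have "\<bar>A\<bar> > \<bar>B\<bar>" using zA nb p by fastforce
      then have "sgn (A + B) = sgn A" by (auto simp: sgn_if)
      then show ?thesis using c1 zA 4 \<open>\<bar>A\<bar> > \<bar>B\<bar>\<close> by (auto simp: sgn_mult)
    next
      case 5
      \<comment> \<open>The first alternative would put the entries in the box, the second would
        make the determinant nonpositive. It is applied to absolute values when both rows contain
        entries of opposite signs.\<close>
      have key: "\<not> (y < x \<and> z < w) \<and> \<not> (x \<le> y \<and> w \<le> z)"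
        if "x > 0" "y > 0" "z > 0" "w > 0" "x * w - y * z = p" "x > p \<or> y > p \<or> z > p \<or> w > p" for x y z w
      proof (intro conjI notI)
        assume "y < x \<and> z < w"
        then have "x \<le> p" "y \<le> p" "z \<le> p" "w \<le> p" using box_if_both_smaller[OF that(1-5)] by blast+
        then show False using that(6) by linarith
      next
        assume "x \<le> y \<and> w \<le> z"
        then have "x * w \<le> y * z" using that by (intro mult_mono) auto
        then show False using that(5) p by linarith
      qed
      have "A * C > 0 \<and> B * D > 0 \<or> A * C < 0 \<and> B * D < 0"
        using eq[OF 5(1,2)] 5(1,2) int_sign_cases[of "A * C"] int_sign_cases[of "B * D"] by linarith
      then show ?thesis
        unfolding zero_less_mult_iff mult_less_0_iff
      proof (elim disjE conjE)
        assume h: "A > 0" "C > 0" "B > 0" "D > 0"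
        then show ?thesis using c1 5 by (simp add: sgn_mult)
      next
        assume h: "A > 0" "C > 0" "B < 0" "D < 0"
        have "\<not> (A < -B \<and> -D < C) \<and> \<not> (-B \<le> A \<and> C \<le> -D)"
          by (rule key[of "-B" A "-D" C]) (use h det nb in \<open>auto simp: abs_if mult.commute\<close>)
        then have "(A + B < 0 \<and> C + D < 0) \<or> (A + B > 0 \<and> C + D > 0)" using 5 by linarith
        then show ?thesis using c1 5 h by (auto simp: sgn_mult)
      next
        assume h: "A < 0" "C < 0" "B > 0" "D > 0"
        have "\<not> (-A < B \<and> D < -C) \<and> \<not> (B \<le> -A \<and> -C \<le> D)"
          by (rule key[of B "-A" D "-C"]) (use h det nb in \<open>auto simp: abs_if mult.commute\<close>)
        then have "(A + B < 0 \<and> C + D < 0) \<or> (A + B > 0 \<and> C + D > 0)" using 5 by linarith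
        then show ?thesis using c1 5 h by (auto simp: sgn_mult)
      next
        assume h: "A < 0" "C < 0" "B < 0" "D < 0"
        then show ?thesis using c1 5 by (simp add: sgn_mult)
      next
        assume h: "A > 0" "C < 0" "B > 0" "D < 0"
        then show ?thesis using c1 5 by (simp add: sgn_mult)
      next
        assume h: "A > 0" "C < 0" "B < 0" "D > 0"
        have "\<not> (-B < A \<and> -C < D) \<and> \<not> (A \<le> -B \<and> D \<le> -C)"
          by (rule key[of A "-B" "-C" D]) (use h det nb in \<open>auto simp: abs_if mult.commute\<close>)
        then have "(A + B < 0 \<and> C + D > 0) \<or> (A + B > 0 \<and> C + D < 0)" using 5 by linarith
        then show ?thesis using c1 5 h by (auto simp: sgn_mult)
      next
        assume h: "A < 0" "C > 0" "B > 0" "D < 0"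
        have "\<not> (B < -A \<and> C < -D) \<and> \<not> (-A \<le> B \<and> -D \<le> C)"
          by (rule key[of "-A" B C "-D"]) (use h det nb in \<open>auto simp: abs_if mult.commute\<close>)
        then have "(A + B < 0 \<and> C + D > 0) \<or> (A + B > 0 \<and> C + D < 0)" using 5 by linarith
        then show ?thesis using c1 5 h by (auto simp: sgn_mult)
      next
        assume h: "A < 0" "C > 0" "B < 0" "D > 0"
        then show ?thesis using c1 5 by (simp add: sgn_mult)
      qed
    qed
  qed
qed

text \<open>Two of the three signs agree with \<open>tau\<close>, and the remaining one cannot
  overturn them.\<close>

lemma tau_eq_maj:
  assumes M: "M \<in> mats p" and p: "p > 0" and box: "M \<notin> box p"
  shows "tau M = maj M"
proof -
  obtain A B C D where Meq: "M = (A, B, C, D)" by (cases M)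
  note nb = tau_outside_box[OF M[unfolded Meq] p box[unfolded Meq]]
  let ?t = "tau (A, B, C, D)"
  have t: "?t = 1 \<or> ?t = -1"
    using nb(4)
  proof
    assume "A * C \<noteq> 0"
    then show ?thesis using nb(1) int_sign_cases[of "A * C"] by linarith
  next
    assume "B * D \<noteq> 0"
    then show ?thesis using nb(2) int_sign_cases[of "B * D"] by linarith
  qed
  have "sgn (sgn (A * C) + sgn (B * D) + sgn ((A + B) * (C + D))) = ?t"
  proof (cases "A * C = 0 \<or> B * D = 0")
    case True
    then have "sgn (A * C) + sgn (B * D) + sgn ((A + B) * (C + D)) = 2 * ?t"
      using nb by (auto simp del: tau.simps)
    then show ?thesis using t by (elim disjE) (simp_all del: tau.simps)
  next
    case False
    then have "sgn (A * C) + sgn (B * D) + sgn ((A + B) * (C + D)) = 2 * ?t + sgn ((A + B) * (C + D))"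
      using nb(1,2) by (simp del: tau.simps)
    then show ?thesis using t int_sign_cases[of "(A + B) * (C + D)"] by (elim disjE conjE) (simp_all del: tau.simps)
  qed
  then show ?thesis unfolding Meq by simp
qed

section \<open>Replacing the fixed point sign by the majority sign\<close>

lemma fin_supp_tau_maj: "p > 0 \<Longrightarrow> fin_supp (mats p) (\<lambda>M. tau M - maj M)"
  by (rule fin_suppI[OF finite_box[of p]]) (metis diff_self tau_eq_maj)

text \<open>U permutes the cusps 0, 1 and infinity cyclically.\<close>

lemma maj_rightU: "maj (rightU M) = maj M"
proof (cases M)
  case (fields A B C D)
  have "sgn (B * D) + sgn ((- A - B) * (- C - D)) + sgn ((B + (- A - B)) * (D + (- C - D))) =
    sgn (A * C) + sgn (B * D) + sgn ((A + B) * (C + D))"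
    by (simp add: sgn_mult algebra_simps)
  then show ?thesis unfolding fields rightU.simps maj.simps by (simp only:)
qed

lemma maj_rightS_rightS: "maj (rightS (rightS M)) = maj M"
proof (cases M)
  case (fields A B C D)
  have "(- A + - B) * (- C + - D) = (A + B) * (C + D)" by (simp add: algebra_simps)
  then show ?thesis unfolding fields rightS.simps maj.simps by simp
qed

text \<open>Left multiplication by S moves every image to the other side of the imaginary axis, and
  the inverse of S is -S.\<close>

lemma maj_conjS: "maj (conjS M) = - maj (rightS M)"
proof (cases M)
  case (fields A B C D)
  have "(D + - C) * (- B + A) = - ((B + - A) * (D + - C))" by (simp add: algebra_simps)
  then have "sgn (D * - B) + sgn (- C * A) + sgn ((D + - C) * (- B + A)) =
    - (sgn (B * D) + sgn (- A * - C) + sgn ((B + - A) * (D + - C)))"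
    by (simp only: int_sgn_minus) (simp add: sgn_mult)
  then show ?thesis unfolding fields conjS.simps rightS.simps maj.simps by (simp only: int_sgn_minus)
qed

text \<open>\<open>maj\<close> is not odd under conjugation by S. Adding the conjugate term leaves a
  weighted difference of \<open>maj (rightS M)\<close> and \<open>maj M\<close>, which is odd under
  right multiplication by S because S^2 = -1.\<close>

lemma fsum_weighted_tau_maj:
  assumes p: "p > 0" and S: "\<And>M. M \<in> mats p \<Longrightarrow> \<chi> (conjS M) = \<chi> M" "\<And>M. M \<in> mats p \<Longrightarrow> \<chi> (rightS M) = \<chi> M"
  shows "fsum (mats p) (\<lambda>M. \<chi> M * (tau M - maj M)) = 0"
proof -
  let ?f = "\<lambda>M. \<chi> M * (tau M - maj M)"
  let ?g = "\<lambda>M. \<chi> M * (maj M - maj (rightS M))"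
  have fin: "fin_supp (mats p) ?f" by (intro fin_supp_mult fin_supp_tau_maj p)
  then have fin': "fin_supp (mats p) (\<lambda>M. ?f (conjS M))"
    using fin_supp_bij[OF bij_mats(5), of p ?f] by simp
  have "fsum (mats p) (\<lambda>M. ?g (rightS M)) = fsum (mats p) (\<lambda>M. - ?g M)"
    by (rule fsum_cong) (simp add: S maj_rightS_rightS algebra_simps)
  then have g: "fsum (mats p) ?g = 0"
    using fsum_bij[OF bij_mats(3), of p ?g] by (simp add: fsum_uminus)
  have "2 * fsum (mats p) ?f = fsum (mats p) ?f + fsum (mats p) (\<lambda>M. ?f (conjS M))"
    using fsum_bij[OF bij_mats(5), of p ?f] by simp
  also have "\<dots> = fsum (mats p) (\<lambda>M. ?f M + ?f (conjS M))" by (rule fsum_add[OF fin fin', symmetric])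
  also have "\<dots> = fsum (mats p) (\<lambda>M. - ?g M)"
    by (rule fsum_cong) (simp add: S tau_conjS maj_conjS algebra_simps)
  also have "\<dots> = 0" using g by (simp add: fsum_uminus)
  finally show ?thesis by simp
qed

lemma fsum_weighted_cyc_maj:
  assumes p: "prime p" and S: "\<And>M. M \<in> mats p \<Longrightarrow> \<chi> (conjS M) = \<chi> M" "\<And>M. M \<in> mats p \<Longrightarrow> \<chi> (rightS M) = \<chi> M"
    and U: "\<And>M. M \<in> mats p \<Longrightarrow> \<chi> (conjU M) = \<chi> M"
  shows "fin_supp (mats p) (\<lambda>M. \<chi> M * cyc maj M)"
    "fsum (mats p) (\<lambda>M. \<chi> M * cyc tau M) = fsum (mats p) (\<lambda>M. \<chi> M * cyc maj M)"
proof -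
  have p0: "p > 0" using p by (simp add: prime_gt_0_int)
  let ?f = "\<lambda>M. \<chi> M * (tau M - maj M)"
  have fin: "fin_supp (mats p) ?f" by (intro fin_supp_mult fin_supp_tau_maj p0)
  note o = fsum_orbit[OF bij_mats(4) fin]
  note t = fin_supp_mult[OF fin_supp_cyc_tau[OF p], of \<chi>]
  have eq: "\<chi> M * cyc tau M - (?f M + ?f (conjU M) + ?f (conjU (conjU M))) = \<chi> M * cyc maj M"
    if "M \<in> mats p" for M
    using U[OF that] U[OF mats_closed(4)[OF that]] by (simp add: cyc_def algebra_simps)
  have "fin_supp (mats p) (\<lambda>M. \<chi> M * cyc tau M - (?f M + ?f (conjU M) + ?f (conjU (conjU M)))) =
    fin_supp (mats p) (\<lambda>M. \<chi> M * cyc maj M)" by (intro fin_supp_cong eq)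
  with fin_supp_diff[OF t o(1)] show "fin_supp (mats p) (\<lambda>M. \<chi> M * cyc maj M)" by simp
  have c: "fsum (mats p) (\<lambda>M. \<chi> M * cyc tau M - (?f M + ?f (conjU M) + ?f (conjU (conjU M)))) =
    fsum (mats p) (\<lambda>M. \<chi> M * cyc maj M)" by (intro fsum_cong eq)
  show "fsum (mats p) (\<lambda>M. \<chi> M * cyc tau M) = fsum (mats p) (\<lambda>M. \<chi> M * cyc maj M)"
    using fsum_diff[OF t o(1)] fsum_weighted_tau_maj[of p \<chi>, OF p0 S] unfolding o(2) c by simp
qed

text \<open>For determinant 1 modulo 3, the condition that the reduction modulo 3 lies in the normal quaternion subgroup of
  order 8. Its three cosets are permuted by right multiplication by U.\<close>
fun quat :: "mat2 \<Rightarrow> bool" where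
  "quat (A, B, C, D) \<longleftrightarrow> 3 dvd A + D \<or> 3 dvd B \<and> 3 dvd C \<and> 3 dvd A - D"

lemma quat_conj: "quat (conjS M) = quat M" "quat (conjU M) = quat M"
proof -
  obtain A B C D where Meq: "M = (A, B, C, D)" by (cases M)
  show "quat (conjS M) = quat M" unfolding Meq by (simp; presburger)
  show "quat (conjU M) = quat M" unfolding Meq by (simp; presburger)
qed

section \<open>Trace, quaternion subgroup and fixed lines modulo 3\<close>

fun tr :: "mat2 \<Rightarrow> int" where "tr (A, B, C, D) = A + D"

text \<open>The four terms belong to the lines spanned by (1, 0), (0, 1), (1, 1) and (1, -1) over the field with three elements.\<close>
fun fixed_lines :: "mat2 \<Rightarrow> int" where
  "fixed_lines (A, B, C, D) = of_bool (3 dvd C) + of_bool (3 dvd B) + of_bool (3 dvd A + B - C - D) + of_bool (3 dvd A - B + C - D)"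

lemma mats_mod_3:
  assumes M: "(A, B, C, D) \<in> mats p"
  shows "((A mod 3) * (D mod 3) - (B mod 3) * (C mod 3)) mod 3 = p mod 3"
proof -
  have "((A mod 3) * (D mod 3) - (B mod 3) * (C mod 3)) mod 3 = (A * D - B * C) mod 3"
    by (intro mod_diff_cong mod_mult_cong) simp_all
  then show ?thesis using M by (simp add: mats_def)
qed

lemma dvd_3_linear:
  fixes A B C D :: int
  shows "3 dvd i * (A mod 3) + j * (B mod 3) + k * (C mod 3) + l * (D mod 3) \<longleftrightarrow> 3 dvd i * A + j * B + k * C + l * D"
proof -
  have "3 dvd i * (A - A mod 3) + j * (B - B mod 3) + k * (C - C mod 3) + l * (D - D mod 3)"
    by (intro dvd_add dvd_mult) (simp_all add: dvd_minus_mod)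
  also have "\<dots> = (i * A + j * B + k * C + l * D) - (i * (A mod 3) + j * (B mod 3) + k * (C mod 3) + l * (D mod 3))"
    by (simp add: algebra_simps)
  finally have "3 dvd (i * A + j * B + k * C + l * D) - (i * (A mod 3) + j * (B mod 3) + k * (C mod 3) + l * (D mod 3))" .
  moreover have "3 dvd v \<longleftrightarrow> 3 dvd u" if "3 dvd u - v" for u v :: int
    using that by presburger
  ultimately show ?thesis by blast
qed

fun mod3 :: "mat2 \<Rightarrow> mat2" where
  "mod3 (A, B, C, D) = (A mod 3, B mod 3, C mod 3, D mod 3)"

lemma quat_right:
  "quat (rightS (A, B, C, D)) \<longleftrightarrow> 3 dvd B - C \<or> 3 dvd A \<and> 3 dvd D \<and> 3 dvd B + C"
  "quat (rightU (A, B, C, D)) \<longleftrightarrow> 3 dvd B - C - D \<or> 3 dvd A + B \<and> 3 dvd D \<and> 3 dvd B + C + D"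
  "quat (rightU (rightU (A, B, C, D))) \<longleftrightarrow> 3 dvd A + B - C \<or> 3 dvd A \<and> 3 dvd C + D \<and> 3 dvd A + B + C"
  by (simp; presburger)+

text \<open>This turns the identities between the weights into finite checks over residues.\<close>

lemma mod3_eq:
  shows "fixed_lines M = fixed_lines (mod3 M)"
    and "3 dvd tr M \<longleftrightarrow> 3 dvd tr (mod3 M)"
    and "quat M \<longleftrightarrow> quat (mod3 M)"
    and "quat (rightS M) \<longleftrightarrow> quat (rightS (mod3 M))"
    and "quat (rightU M) \<longleftrightarrow> quat (rightU (mod3 M))"
    and "quat (rightU (rightU M)) \<longleftrightarrow> quat (rightU (rightU (mod3 M)))"
proof -
  obtain A B C D where Meq: "M = (A, B, C, D)" by (cases M)
  show "fixed_lines M = fixed_lines (mod3 M)"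
    unfolding Meq mod3.simps fixed_lines.simps
    using dvd_3_linear[of 0 A 0 B 1 C 0 D]  dvd_3_linear[of 0 A 1 B 0 C 0 D]  dvd_3_linear[of 1 A 1 B "-1" C "-1" D]  dvd_3_linear[of 1 A "-1" B 1 C "-1" D]
    by simp
  show "3 dvd tr M \<longleftrightarrow> 3 dvd tr (mod3 M)"
    unfolding Meq mod3.simps tr.simps
    using dvd_3_linear[of 1 A 0 B 0 C 1 D]
    by simp
  show "quat M \<longleftrightarrow> quat (mod3 M)"
    unfolding Meq mod3.simps quat.simps
    using dvd_3_linear[of 1 A 0 B 0 C 1 D]  dvd_3_linear[of 0 A 1 B 0 C 0 D]  dvd_3_linear[of 0 A 0 B 1 C 0 D]  dvd_3_linear[of 1 A 0 B 0 C "-1" D]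
    by simp
  show "quat (rightS M) \<longleftrightarrow> quat (rightS (mod3 M))"
    unfolding Meq mod3.simps quat_right
    using dvd_3_linear[of 0 A 1 B "-1" C 0 D]  dvd_3_linear[of 1 A 0 B 0 C 0 D]  dvd_3_linear[of 0 A 0 B 0 C 1 D]  dvd_3_linear[of 0 A 1 B 1 C 0 D]
    by simp
  show "quat (rightU M) \<longleftrightarrow> quat (rightU (mod3 M))"
    unfolding Meq mod3.simps quat_right
    using dvd_3_linear[of 0 A 1 B "-1" C "-1" D]  dvd_3_linear[of 1 A 1 B 0 C 0 D]  dvd_3_linear[of 0 A 0 B 0 C 1 D]  dvd_3_linear[of 0 A 1 B 1 C 1 D]
    by simp
  show "quat (rightU (rightU M)) \<longleftrightarrow> quat (rightU (rightU (mod3 M)))"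
    unfolding Meq mod3.simps quat_right
    using dvd_3_linear[of 1 A 1 B "-1" C 0 D]  dvd_3_linear[of 1 A 0 B 0 C 0 D]  dvd_3_linear[of 0 A 0 B 1 C 1 D]  dvd_3_linear[of 1 A 1 B 1 C 0 D]
    by simp
qed

lemma mod3_cases:
  assumes "M \<in> mats p"
  obtains a b c d where "mod3 M = (a, b, c, d)" "(a * d - b * c) mod 3 = p mod 3"
    "a = 0 \<or> a = 1 \<or> a = 2" "b = 0 \<or> b = 1 \<or> b = 2" "c = 0 \<or> c = 1 \<or> c = 2" "d = 0 \<or> d = 1 \<or> d = 2"
proof -
  obtain A B C D where Meq: "M = (A, B, C, D)" by (cases M)
  have "x mod 3 = 0 \<or> x mod 3 = 1 \<or> x mod 3 = 2" for x :: int by presburger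
  with mats_mod_3[of A B C D p] assms show thesis
    by (intro that[of "A mod 3" "B mod 3" "C mod 3" "D mod 3"]) (auto simp: Meq)
qed

text \<open>The determinant is 1 modulo 3. In the quaternion subgroup the elements of order 4 have
  trace 0 and fix no line, while 1 and -1 fix all four lines; every element outside fixes exactly
  one line and has nonzero trace.\<close>

lemma
  assumes M: "M \<in> mats p" and p: "p mod 3 = 1"
  shows quat_rightS: "quat (rightS M) = quat M"
    and quat_rightU: "of_bool (quat M) + of_bool (quat (rightU M)) + of_bool (quat (rightU (rightU M))) = (1 :: int)"
    and trace_indicator_1: "4 * of_bool (3 dvd tr M) = 1 + 3 * of_bool (quat M) - fixed_lines M"
proof -
  obtain a b c d where m: "mod3 M = (a, b, c, d)" and det: "(a * d - b * c) mod 3 = p mod 3"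
    and r: "a = 0 \<or> a = 1 \<or> a = 2" "b = 0 \<or> b = 1 \<or> b = 2" "c = 0 \<or> c = 1 \<or> c = 2" "d = 0 \<or> d = 1 \<or> d = 2"
    by (rule mod3_cases[OF M])
  have "quat (rightS (a, b, c, d)) = quat (a, b, c, d) \<and>
    of_bool (quat (a, b, c, d)) + of_bool (quat (rightU (a, b, c, d))) + of_bool (quat (rightU (rightU (a, b, c, d)))) = (1 :: int) \<and>
    4 * of_bool (3 dvd tr (a, b, c, d)) = 1 + 3 * of_bool (quat (a, b, c, d)) - fixed_lines (a, b, c, d)"
    using det r unfolding p by (elim disjE) simp_all
  then show "quat (rightS M) = quat M"
    "of_bool (quat M) + of_bool (quat (rightU M)) + of_bool (quat (rightU (rightU M))) = (1 :: int)"
    "4 * of_bool (3 dvd tr M) = 1 + 3 * of_bool (quat M) - fixed_lines M"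
    unfolding mod3_eq[of M] m by simp_all
qed

text \<open>The determinant is -1 modulo 3. Trace 0 means eigenvalues 1 and -1, hence two fixed
  lines; for any other trace the characteristic polynomial is irreducible.\<close>

lemma trace_indicator_2:
  assumes M: "M \<in> mats p" and p: "p mod 3 = 2"
  shows "2 * of_bool (3 dvd tr M) = fixed_lines M"
proof -
  obtain a b c d where m: "mod3 M = (a, b, c, d)" and det: "(a * d - b * c) mod 3 = p mod 3"
    and r: "a = 0 \<or> a = 1 \<or> a = 2" "b = 0 \<or> b = 1 \<or> b = 2" "c = 0 \<or> c = 1 \<or> c = 2" "d = 0 \<or> d = 1 \<or> d = 2"
    by (rule mod3_cases[OF M])
  have "2 * of_bool (3 dvd tr (a, b, c, d)) = fixed_lines (a, b, c, d)"
    using det r unfolding p by (elim disjE) simp_all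
  then show ?thesis unfolding mod3_eq[of M] m .
qed

lemma conjU_rightU: "conjU (rightU M) = rightU (conjU M)"
  by (cases M) simp

text \<open>Right multiplication by U preserves \<open>cyc maj\<close> and permutes the three cosets
  of the quaternion subgroup, so each coset carries one third of the total.\<close>

lemma fsum_quat_cyc_tau:
  assumes p: "prime p" "p mod 3 = 1"
  shows "3 * fsum (mats p) (\<lambda>M. of_bool (quat M) * cyc tau M) = 12 * (p + 1)"
proof -
  let ?q = "\<lambda>M. of_bool (quat M) :: int"
  note q = fsum_weighted_cyc_maj[OF p(1), of ?q]
  note q1 = fsum_weighted_cyc_maj(2)[OF p(1), of "\<lambda>_. 1"]
  have S: "?q (conjS M) = ?q M" "?q (conjU M) = ?q M" "?q (rightS M) = ?q M" if "M \<in> mats p" for M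
    using quat_conj quat_rightS[OF that p(2)] by simp_all
  note o = fsum_orbit(2)[OF bij_mats(2) q(1)[OF S(1,3,2)]]
  have c: "cyc maj (rightU M) = cyc maj M" for M
    unfolding cyc_def conjU_rightU maj_rightU ..
  have "3 * fsum (mats p) (\<lambda>M. ?q M * cyc tau M) = fsum (mats p)
    (\<lambda>M. ?q M * cyc maj M + ?q (rightU M) * cyc maj (rightU M) + ?q (rightU (rightU M)) * cyc maj (rightU (rightU M)))"
    using o q(2)[OF S(1,3,2)] by simp
  also have "\<dots> = fsum (mats p) (cyc maj)"
  proof (rule fsum_cong)
    fix M assume "M \<in> mats p"
    then show "?q M * cyc maj M + ?q (rightU M) * cyc maj (rightU M) + ?q (rightU (rightU M)) * cyc maj (rightU (rightU M)) = cyc maj M"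
      using quat_rightU[OF _ p(2)] by (simp only: c distrib_right[symmetric] mult_1_left)
  qed
  also have "\<dots> = 12 * (p + 1)" using q1 fsum_cyc_tau[OF p(1)] by simp
  finally show ?thesis .
qed

subsection \<open>The count weighted by fixed lines\<close>

text \<open>The sign of the image of a single cusp. If infinity or 0 is itself fixed, its image has
  no sign, and the image of the other end of the edge is used instead.\<close>

fun cusp_inf :: "mat2 \<Rightarrow> int" where "cusp_inf (A, B, C, D) = (if C = 0 then sgn (B * D) else sgn (A * C))"
fun cusp_0 :: "mat2 \<Rightarrow> int" where "cusp_0 (A, B, C, D) = (if B = 0 then sgn (A * C) else sgn (B * D))"
fun cusp_1 :: "mat2 \<Rightarrow> int" where "cusp_1 (A, B, C, D) = sgn ((A + B) * (C + D))"
fun cusp_m1 :: "mat2 \<Rightarrow> int" where "cusp_m1 (A, B, C, D) = sgn ((A - B) * (C - D))"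

fun fix_inf :: "mat2 \<Rightarrow> int" where "fix_inf (A, B, C, D) = of_bool (3 dvd C)"
fun fix_0 :: "mat2 \<Rightarrow> int" where "fix_0 (A, B, C, D) = of_bool (3 dvd B)"
fun fix_1 :: "mat2 \<Rightarrow> int" where "fix_1 (A, B, C, D) = of_bool (3 dvd A + B - C - D)"
fun fix_m1 :: "mat2 \<Rightarrow> int" where "fix_m1 (A, B, C, D) = of_bool (3 dvd A - B + C - D)"

lemma fixed_lines_eq: "fixed_lines M = fix_inf M + fix_0 M + fix_1 M + fix_m1 M"
  by (cases M) simp

lemma cusp_conjS:
  "cusp_inf (conjS M) = - cusp_0 M" "cusp_0 (conjS M) = - cusp_inf M"
  "cusp_1 (conjS M) = - cusp_m1 M" "cusp_m1 (conjS M) = - cusp_1 M"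
proof -
  obtain A B C D where Meq: "M = (A, B, C, D)" by (cases M)
  show "cusp_inf (conjS M) = - cusp_0 M" "cusp_0 (conjS M) = - cusp_inf M"
    unfolding Meq by (simp_all add: sgn_mult)
  have "(D + - C) * (- B + A) = - ((A - B) * (C - D))" "(D - - C) * (- B - A) = - ((A + B) * (C + D))"
    by (simp_all add: algebra_simps)
  then show "cusp_1 (conjS M) = - cusp_m1 M" "cusp_m1 (conjS M) = - cusp_1 M"
    unfolding Meq conjS.simps cusp_1.simps cusp_m1.simps by (simp_all only: int_sgn_minus)
qed

lemma fix_conjS:
  "fix_inf (conjS M) = fix_0 M" "fix_0 (conjS M) = fix_inf M"
  "fix_1 (conjS M) = fix_m1 M" "fix_m1 (conjS M) = fix_1 M"
proof -
  obtain A B C D where Meq: "M = (A, B, C, D)" by (cases M)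
  have "3 dvd D + - C - - B - A \<longleftrightarrow> 3 dvd A - B + C - D" "3 dvd D - - C + - B - A \<longleftrightarrow> 3 dvd A + B - C - D"
    by presburger+
  then show "fix_1 (conjS M) = fix_m1 M" "fix_m1 (conjS M) = fix_1 M"
    unfolding Meq conjS.simps fix_1.simps fix_m1.simps by simp_all
qed (cases M; simp)+

lemma fix_conjU:
  "fix_inf (conjU M) = fix_1 M" "fix_0 (conjU M) = fix_inf M" "fix_1 (conjU M) = fix_0 M" "fix_m1 (conjU M) = fix_m1 M"
proof -
  obtain A B C D where Meq: "M = (A, B, C, D)" by (cases M)
  have "3 dvd C + D - A - B \<longleftrightarrow> 3 dvd A + B - C - D"
    "3 dvd C + D + - C - (C + D - A - B) - (A - C) \<longleftrightarrow> 3 dvd B"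
    "3 dvd C + D - - C + (C + D - A - B) - (A - C) \<longleftrightarrow> 3 dvd A - B + C - D"
    by presburger+
  then show "fix_inf (conjU M) = fix_1 M" "fix_1 (conjU M) = fix_0 M" "fix_m1 (conjU M) = fix_m1 M"
    unfolding Meq conjU.simps fix_inf.simps fix_0.simps fix_1.simps fix_m1.simps by (simp_all only:)
  show "fix_0 (conjU M) = fix_inf M" unfolding Meq by simp
qed

text \<open>Modulo 3, (1, -1) is an eigenvector of U with eigenvalue 1, so even one-sided
  multiplication by U preserves this condition.\<close>

lemma fix_m1_left_right: "fix_m1 (leftU M) = fix_m1 M" "fix_m1 (rightU M) = fix_m1 M"
proof -
  obtain A B C D where Meq: "M = (A, B, C, D)" by (cases M)
  have "3 dvd - C - - D + (A - C) - (B - D) \<longleftrightarrow> 3 dvd A - B + C - D"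
    "3 dvd B - (- A - B) + D - (- C - D) \<longleftrightarrow> 3 dvd A - B + C - D"
    by presburger+
  then show "fix_m1 (leftU M) = fix_m1 M" "fix_m1 (rightU M) = fix_m1 M"
    unfolding Meq leftU.simps rightU.simps fix_m1.simps by (simp_all only:)
qed

lemma
  assumes M: "(A, B, C, D) \<in> mats p" and p: "\<not> 3 dvd p"
  shows not_dvd_inf: "3 dvd C \<Longrightarrow> \<not> 3 dvd A \<and> \<not> 3 dvd D"
    and not_dvd_1: "3 dvd A + B - C - D \<Longrightarrow> \<not> 3 dvd A + B \<and> \<not> 3 dvd C + D"
    and not_dvd_m1: "3 dvd A - B + C - D \<Longrightarrow> \<not> 3 dvd A - B \<and> \<not> 3 dvd C - D"
proof -
  have det: "p = A * D - B * C" using M by (simp add: mats_def)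
  show "\<not> 3 dvd A \<and> \<not> 3 dvd D" if "3 dvd C"
    using p that unfolding det by (meson dvd_diff dvd_mult dvd_mult2)
  show "\<not> 3 dvd A + B \<and> \<not> 3 dvd C + D" if h: "3 dvd A + B - C - D"
  proof -
    have "3 dvd A + B \<longleftrightarrow> 3 dvd C + D" using h by presburger
    moreover have "p = (A + B) * D - B * (C + D)" unfolding det by (simp add: algebra_simps)
    ultimately show ?thesis using p by (metis dvd_diff dvd_mult dvd_mult2)
  qed
  show "\<not> 3 dvd A - B \<and> \<not> 3 dvd C - D" if h: "3 dvd A - B + C - D"
  proof -
    have "3 dvd A - B \<longleftrightarrow> 3 dvd C - D" using h by presburger
    moreover have "p = (A - B) * D - B * (C - D)" unfolding det by (simp add: algebra_simps)
    ultimately show ?thesis using p by (metis dvd_diff dvd_mult dvd_mult2)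
  qed
qed

text \<open>If the line of a cusp is fixed modulo 3, its image reduces to the same line. So the
  image of infinity is not 0 and that of 1 is neither 0 nor infinity, and
  \<open>tau_outside_box\<close> applies. The cusps 0 and -1 follow by conjugation with S.\<close>

lemma fin_supp_cusps:
  assumes p: "p > 0" "\<not> 3 dvd p"
  shows "fin_supp (mats p) (\<lambda>M. fix_inf M * (tau M - cusp_inf M))"
    "fin_supp (mats p) (\<lambda>M. fix_0 M * (tau M - cusp_0 M))"
    "fin_supp (mats p) (\<lambda>M. fix_1 M * (tau M - cusp_1 M))"
    "fin_supp (mats p) (\<lambda>M. fix_m1 M * (tau M - cusp_m1 M))"
proof -
  show inf: "fin_supp (mats p) (\<lambda>M. fix_inf M * (tau M - cusp_inf M))"
  proof (rule fin_suppI[OF finite_box[of p]], rule ccontr)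
    fix M assume M: "M \<in> mats p" "fix_inf M * (tau M - cusp_inf M) \<noteq> 0" "M \<notin> box p"
    obtain A B C D where Meq: "M = (A, B, C, D)" by (cases M)
    have "3 dvd C" using M(2) by (cases "3 dvd C") (simp_all add: Meq del: tau.simps cusp_inf.simps)
    then have "A \<noteq> 0" "D \<noteq> 0" using not_dvd_inf[of A B C D p] M(1) p Meq by auto
    then have "tau M = cusp_inf M"
      using tau_outside_box[of A B C D p] M p Meq by (cases "C = 0") (simp_all del: tau.simps)
    then show False using M by simp
  qed
  show one: "fin_supp (mats p) (\<lambda>M. fix_1 M * (tau M - cusp_1 M))"
  proof (rule fin_suppI[OF finite_box[of p]], rule ccontr)
    fix M assume M: "M \<in> mats p" "fix_1 M * (tau M - cusp_1 M) \<noteq> 0" "M \<notin> box p"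
    obtain A B C D where Meq: "M = (A, B, C, D)" by (cases M)
    have "3 dvd A + B - C - D" using M(2) by (cases "3 dvd A + B - C - D") (simp_all add: Meq del: tau.simps cusp_1.simps)
    then have "A + B \<noteq> 0" "C + D \<noteq> 0" using not_dvd_1[of A B C D p] M(1) p Meq by auto
    then have "tau M = cusp_1 M"
      using tau_outside_box(3)[of A B C D p] M p Meq by (simp del: tau.simps)
    then show False using M by simp
  qed
  have neg: "f * (- t - - s) = - (f * (t - s))" for f t s :: int by (simp add: algebra_simps)
  have uminus: "fin_supp X (\<lambda>M. - f M) = fin_supp X f" for X :: "mat2 set" and f by (simp add: fin_supp_def)
  show "fin_supp (mats p) (\<lambda>M. fix_0 M * (tau M - cusp_0 M))"
    using inf fin_supp_bij[OF bij_mats(5), of p "\<lambda>M. fix_inf M * (tau M - cusp_inf M)"]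
    unfolding tau_conjS cusp_conjS fix_conjS neg uminus by simp
  show "fin_supp (mats p) (\<lambda>M. fix_m1 M * (tau M - cusp_m1 M))"
    using one fin_supp_bij[OF bij_mats(5), of p "\<lambda>M. fix_1 M * (tau M - cusp_1 M)"]
    unfolding tau_conjS cusp_conjS fix_conjS neg uminus by simp
qed

lemma fsum_cusps:
  "fsum (mats p) (\<lambda>M. fix_0 M * (tau M - cusp_0 M)) = - fsum (mats p) (\<lambda>M. fix_inf M * (tau M - cusp_inf M))"
  "fsum (mats p) (\<lambda>M. fix_m1 M * (tau M - cusp_m1 M)) = - fsum (mats p) (\<lambda>M. fix_1 M * (tau M - cusp_1 M))"
proof -
  have neg: "f * (- t - - s) = - (f * (t - s))" for f t s :: int by (simp add: algebra_simps)
  show "fsum (mats p) (\<lambda>M. fix_0 M * (tau M - cusp_0 M)) = - fsum (mats p) (\<lambda>M. fix_inf M * (tau M - cusp_inf M))"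
    using fsum_bij[OF bij_mats(5), of p "\<lambda>M. fix_inf M * (tau M - cusp_inf M)"]
    unfolding tau_conjS cusp_conjS fix_conjS neg fsum_uminus by linarith
  show "fsum (mats p) (\<lambda>M. fix_m1 M * (tau M - cusp_m1 M)) = - fsum (mats p) (\<lambda>M. fix_1 M * (tau M - cusp_1 M))"
    using fsum_bij[OF bij_mats(5), of p "\<lambda>M. fix_1 M * (tau M - cusp_1 M)"]
    unfolding tau_conjS cusp_conjS fix_conjS neg fsum_uminus by linarith
qed

text \<open>For a matrix fixing the line of infinity, the images of infinity contribute nothing unless C = 0, and then the
  contributions of a matrix and its adjugate cancel.\<close>
fun adjugate :: "mat2 \<Rightarrow> mat2" where "adjugate (A, B, C, D) = (D, -B, -C, A)"

lemma bij_adjugate: "bij_betw adjugate (mats p) (mats p)"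
  by (rule bij_betw_byWitness[where f' = adjugate]) (auto simp: mats_def)

lemma fsum_cusp_inf_cycle:
  assumes p: "p > 0" "\<not> 3 dvd p"
  shows "fsum (mats p) (\<lambda>M. fix_inf M * (cusp_inf M + cusp_0 (conjU M) + cusp_1 (conjU (conjU M)) - 1)) = 0"
proof -
  let ?f = "\<lambda>M. fix_inf M * (cusp_inf M + cusp_0 (conjU M) + cusp_1 (conjU (conjU M)) - 1)"
  have val: "?f (A, B, C, D) = (if C = 0 then sgn (B * D) + sgn (D * (D - A - B)) else 0)"
    if M: "(A, B, C, D) \<in> mats p" for A B C D
  proof (cases "3 dvd C")
    case True
    then have nd: "\<not> 3 dvd A" "\<not> 3 dvd D" using not_dvd_inf[OF M p(2)] by auto
    then have A0: "A \<noteq> 0" by auto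
    have c1: "cusp_1 (conjU (conjU (A, B, C, D))) = sgn (A * (A - C))"
      unfolding conjU_conjU cusp_1.simps by (simp add: algebra_simps)
    show ?thesis
    proof (cases "C = 0")
      case True
      then show ?thesis using A0 unfolding c1 by (auto simp: sgn_mult sgn_if zero_less_mult_iff)
    next
      case False
      \<comment> \<open>The three terms are the positions of \<open>A / C\<close> relative to the
        three edges, and these add up to 1 by \<open>arc_cases\<close>.\<close>
      have "cusp_0 (conjU (A, B, C, D)) = sgn (C * (C - A))"
        using False by (simp add: algebra_simps)
      moreover have "A \<noteq> C" using True nd by auto
      ultimately show ?thesis
        using arc_cases[of A C] A0 False True unfolding c1 by (auto simp: sgn_0_0)
    qed
  qed auto
  have "fsum (mats p) (\<lambda>M. ?f (adjugate M)) = fsum (mats p) (\<lambda>M. - ?f M)"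
  proof (rule fsum_cong)
    fix M assume M: "M \<in> mats p"
    obtain A B C D where Meq: "M = (A, B, C, D)" by (cases M)
    have M': "(D, -B, -C, A) \<in> mats p" using M by (auto simp: Meq mats_def algebra_simps)
    have "sgn (- B * A) + sgn (A * (A - D - - B)) = - (sgn (B * D) + sgn (D * (D - A - B)))" if "C = 0"
    proof -
      have "A * D > 0" using M p that by (auto simp: Meq mats_def)
      then have "sgn A = sgn D" by (auto simp: zero_less_mult_iff)
      moreover have "A - D - - B = - (D - A - B)" by simp
      ultimately show ?thesis by (simp only: sgn_mult int_sgn_minus)
    qed
    then show "?f (adjugate M) = - ?f M"
      using val[OF M[unfolded Meq]] val[OF M'] unfolding Meq adjugate.simps by simp
  qed
  then show ?thesis
    using fsum_bij[OF bij_adjugate, of p ?f] unfolding fsum_uminus by linarith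
qed

text \<open>The image of -1 is congruent to -1 modulo 3, so it is none of the vertices 0, 1 and
  infinity. All three signs are nonzero, and they add up to 1 by \<open>arc_cases\<close>.\<close>

lemma left_orbit_cusp_m1:
  assumes M: "M \<in> mats p" and p: "\<not> 3 dvd p" and nz: "fix_m1 M \<noteq> 0"
  shows "left_orbit cusp_m1 M = 1"
proof -
  obtain A B C D where Meq: "M = (A, B, C, D)" by (cases M)
  have h: "3 dvd A - B + C - D" using nz by (simp add: Meq split: if_splits)
  then have nd: "\<not> 3 dvd A - B \<and> \<not> 3 dvd C - D" using not_dvd_m1[of A B C D p] M p Meq by auto
  then have ne: "A - B \<noteq> 0" "C - D \<noteq> 0" by auto
  have ne2: "A - B \<noteq> C - D" using nd h by presburger
  have e: "cusp_m1 (leftU M) = sgn ((C - D) * ((C - D) - (A - B)))" "cusp_m1 (leftU (leftU M)) = sgn ((A - B) * ((A - B) - (C - D)))"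
    unfolding Meq leftU.simps cusp_m1.simps by (simp_all add: algebra_simps)
  have "cusp_m1 M = sgn ((A - B) * (C - D))" by (simp add: Meq)
  moreover have "sgn ((A - B) * (C - D)) \<noteq> 0" "sgn ((C - D) * ((C - D) - (A - B))) \<noteq> 0" "sgn ((A - B) * ((A - B) - (C - D))) \<noteq> 0"
    using ne ne2 by (auto simp: sgn_0_0)
  ultimately show ?thesis
    using arc_cases[of "A - B" "C - D"] ne unfolding left_orbit_def e by auto
qed

text \<open>What remains are the errors of the replacements. Those for 0 and infinity cancel, so
  each of the lines of infinity, 0 and 1 contributes the error \<open>?e\<close> of the cusp 1. The
  line of -1 contributes three times the error of the cusp -1, which is \<open>- ?e\<close>.\<close>

lemma fsum_fixed_lines_cyc_tau:
  assumes p: "prime p" "\<not> 3 dvd p"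
  shows "fsum (mats p) (\<lambda>M. fixed_lines M * cyc tau M) = 0"
proof -
  have p0: "p > 0" using p by (simp add: prime_gt_0_int)
  note fin = fin_supp_mult[OF fin_supp_cyc_tau[OF p(1)]]
  note fc = fin_supp_cusps[OF p0 p(2)]
  let ?X = "mats p"
  let ?e = "fsum ?X (\<lambda>M. fix_1 M * (tau M - cusp_1 M))"
  let ?i = "fsum ?X (\<lambda>M. fix_inf M * (tau M - cusp_inf M))"
  have s1: "fsum ?X (\<lambda>M. fix_1 M * cyc tau M) = fsum ?X (\<lambda>M. fix_inf M * cyc tau M)"
    using fsum_conjU[of p "\<lambda>M. fix_inf M * cyc tau M"] by (simp add: fix_conjU cyc_conjU)
  have s0: "fsum ?X (\<lambda>M. fix_0 M * cyc tau M) = fsum ?X (\<lambda>M. fix_inf M * cyc tau M)"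
    using fsum_conjU[of p "\<lambda>M. fix_0 M * cyc tau M"] by (simp add: fix_conjU cyc_conjU)
  have inf: "fsum ?X (\<lambda>M. fix_inf M * cyc tau M) = ?e"
  proof -
    let ?f = "\<lambda>M. fix_inf M * (tau M - cusp_inf M)" and ?g = "\<lambda>M. fix_0 M * (tau M - cusp_0 M)"
      and ?h = "\<lambda>M. fix_1 M * (tau M - cusp_1 M)"
    have fg: "fin_supp ?X (\<lambda>M. ?g (conjU M))" using fc(2) fin_supp_bij[OF bij_mats(4), of p ?g] by simp
    have fh: "fin_supp ?X (\<lambda>M. ?h (conjU (conjU M)))"
      using fc(3) fin_supp_bij[OF bij_mats(4), of p ?h] fin_supp_bij[OF bij_mats(4), of p "\<lambda>M. ?h (conjU M)"] by simp
    have sg: "fsum ?X (\<lambda>M. ?g (conjU M)) = - ?i"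
      unfolding fsum_conjU[of p ?g] by (rule fsum_cusps)
    have sh: "fsum ?X (\<lambda>M. ?h (conjU (conjU M))) = ?e"
      unfolding fsum_conjU[of p "\<lambda>M. ?h (conjU M)"] fsum_conjU[of p ?h] ..
    have "fsum ?X (\<lambda>M. fix_inf M * cyc tau M) - fsum ?X (\<lambda>M. ?f M + ?g (conjU M) + ?h (conjU (conjU M))) =
      fsum ?X (\<lambda>M. fix_inf M * cyc tau M - (?f M + ?g (conjU M) + ?h (conjU (conjU M))))"
      by (rule fsum_diff[symmetric]) (intro fin fin_supp_add fc fg fh)+
    also have "\<dots> = fsum ?X (\<lambda>M. fix_inf M * (cusp_inf M + cusp_0 (conjU M) + cusp_1 (conjU (conjU M)) - 1))"
      by (rule fsum_cong) (simp add: cyc_def fix_conjU algebra_simps)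
    also have "\<dots> = 0" by (rule fsum_cusp_inf_cycle[OF p0 p(2)])
    finally show ?thesis
      by (simp only: fsum_add[OF fin_supp_add[OF fc(1) fg] fh] fsum_add[OF fc(1) fg] sg sh)
  qed
  have m1: "fsum ?X (\<lambda>M. fix_m1 M * cyc tau M) = - 3 * ?e"
  proof -
    let ?f = "\<lambda>M. fix_m1 M * (tau M - cusp_m1 M)"
    note o = fsum_orbit[OF bij_mats(4) fc(4)]
    have eq: "fix_m1 M * cyc tau M - (?f M + ?f (conjU M) + ?f (conjU (conjU M))) = fix_m1 M * cyc cusp_m1 M" for M
      by (simp add: cyc_def fix_conjU algebra_simps)
    have f: "fin_supp ?X (\<lambda>M. fix_m1 M * cyc cusp_m1 M)" using fin_supp_diff[OF fin[of fix_m1] o(1)] unfolding eq .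
    have "3 * fsum ?X (\<lambda>M. fix_m1 M * cyc cusp_m1 M) =
      fsum ?X (\<lambda>M. fix_m1 M * cyc cusp_m1 M + fix_m1 (leftU M) * cyc cusp_m1 (leftU M)
        + fix_m1 (leftU (leftU M)) * cyc cusp_m1 (leftU (leftU M)))"
      by (rule fsum_orbit(2)[OF bij_mats(1) f, symmetric])
    also have "\<dots> = fsum ?X (\<lambda>M. 0)"
    proof (rule fsum_cong)
      fix M assume M: "M \<in> ?X"
      have z: "fix_m1 N * (left_orbit cusp_m1 N - 1) = 0" if "N \<in> ?X" for N
        using left_orbit_cusp_m1[OF that p(2)] by auto
      have "fix_m1 M * (cyc cusp_m1 M + cyc cusp_m1 (leftU M) + cyc cusp_m1 (leftU (leftU M))) =
        fix_m1 M * (left_orbit cusp_m1 M - 1) + fix_m1 (rightU M) * (left_orbit cusp_m1 (rightU M) - 1)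
        + fix_m1 (rightU (rightU M)) * (left_orbit cusp_m1 (rightU (rightU M)) - 1)"
        unfolding sum_cyc_leftU by (simp only: fix_m1_left_right distrib_left)
      also have "\<dots> = 0"
        using z[OF M] z[OF mats_closed(2)[OF M]] z[OF mats_closed(2)[OF mats_closed(2)[OF M]]] by (simp only: add_0)
      finally show "fix_m1 M * cyc cusp_m1 M + fix_m1 (leftU M) * cyc cusp_m1 (leftU M)
        + fix_m1 (leftU (leftU M)) * cyc cusp_m1 (leftU (leftU M)) = 0"
        by (simp only: fix_m1_left_right distrib_left)
    qed
    finally have "fsum ?X (\<lambda>M. fix_m1 M * cyc cusp_m1 M) = 0" by (simp add: fsum_def)
    then have "fsum ?X (\<lambda>M. fix_m1 M * cyc tau M) = 3 * fsum ?X ?f"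
      using fsum_diff[OF fin o(1), of fix_m1] unfolding eq o(2) by simp
    then show ?thesis using fsum_cusps(2)[of p] by simp
  qed
  have "fsum ?X (\<lambda>M. fixed_lines M * cyc tau M) =
    fsum ?X (\<lambda>M. fix_inf M * cyc tau M + fix_0 M * cyc tau M + fix_1 M * cyc tau M + fix_m1 M * cyc tau M)"
    unfolding fixed_lines_eq by (simp only: distrib_right)
  also have "\<dots> = 0"
    by (simp only: fsum_add[OF fin_supp_add[OF fin_supp_add[OF fin fin] fin] fin] fsum_add[OF fin_supp_add[OF fin fin] fin]
          fsum_add[OF fin fin] s0 s1 inf m1)
  finally show ?thesis .
qed

subsection \<open>Reduction of forms and the Hurwitz class number\<close>

abbreviation form_rel :: "nat \<Rightarrow> qform rel" where
  "form_rel N \<equiv> sl2_equiv \<inter> (forms_disc N \<times> forms_disc N)"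

lemma in_forms_disc: "(a, b, c) \<in> forms_disc N \<longleftrightarrow> a > 0 \<and> b^2 - 4 * a * c < 0 \<and> b^2 - 4 * a * c = - int N"
  by (auto simp: forms_disc_def pos_def_def disc_def)

section \<open>The substitution action and equivalence of forms\<close>

lemma act_act:
  "act \<alpha>' \<beta>' \<gamma>' \<delta>' (act \<alpha> \<beta> \<gamma> \<delta> Q) =
   act (\<alpha> * \<alpha>' + \<beta> * \<gamma>') (\<alpha> * \<beta>' + \<beta> * \<delta>') (\<gamma> * \<alpha>' + \<delta> * \<gamma>') (\<gamma> * \<beta>' + \<delta> * \<delta>') Q"
  by (cases Q) (simp add: act_def algebra_simps power2_eq_square)

lemma disc_act: "disc (act \<alpha> \<beta> \<gamma> \<delta> Q) = (\<alpha> * \<delta> - \<beta> * \<gamma>)^2 * disc Q"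
  by (cases Q) (simp add: act_def disc_def algebra_simps power2_eq_square)

lemma act_forms_disc:
  assumes Q: "Q \<in> forms_disc N" and det: "\<alpha> * \<delta> - \<beta> * \<gamma> = 1"
  shows "act \<alpha> \<beta> \<gamma> \<delta> Q \<in> forms_disc N"
proof -
  obtain a b c where Qeq: "Q = (a, b, c)" by (cases Q)
  have abc: "a > 0" "b^2 - 4 * a * c < 0" using Q by (auto simp: Qeq in_forms_disc)
  have "4 * a * (a * \<alpha>^2 + b * \<alpha> * \<gamma> + c * \<gamma>^2) = (2 * a * \<alpha> + b * \<gamma>)^2 + (4 * a * c - b^2) * \<gamma>^2"
    by (simp add: algebra_simps power2_eq_square)
  also have "\<dots> > 0"
  proof (cases "\<gamma> = 0")
    case True
    then have "\<alpha> \<noteq> 0" using det by auto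
    then show ?thesis using True abc by simp
  next
    case False
    then have "(4 * a * c - b^2) * \<gamma>^2 > 0" using abc by (intro mult_pos_pos) auto
    then show ?thesis using zero_le_power2[of "2 * a * \<alpha> + b * \<gamma>"] by linarith
  qed
  finally have "a * \<alpha>^2 + b * \<alpha> * \<gamma> + c * \<gamma>^2 > 0"
    using abc by (simp add: zero_less_mult_iff)
  moreover have "disc (act \<alpha> \<beta> \<gamma> \<delta> Q) = disc Q" using disc_act det by simp
  ultimately show ?thesis
    using Q by (auto simp: Qeq act_def forms_disc_def pos_def_def disc_def)
qed

lemma sl2_equivI: "\<alpha> * \<delta> - \<beta> * \<gamma> = 1 \<Longrightarrow> act \<alpha> \<beta> \<gamma> \<delta> Q = Q' \<Longrightarrow> (Q, Q') \<in> sl2_equiv"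
  by (auto simp: sl2_equiv_def)

lemma sl2_equiv_trans:
  assumes "(Q, Q') \<in> sl2_equiv" "(Q', Q'') \<in> sl2_equiv" shows "(Q, Q'') \<in> sl2_equiv"
proof -
  obtain \<alpha> \<beta> \<gamma> \<delta> where 1: "\<alpha> * \<delta> - \<beta> * \<gamma> = 1" "Q' = act \<alpha> \<beta> \<gamma> \<delta> Q" using assms(1) by (auto simp: sl2_equiv_def)
  obtain \<alpha>' \<beta>' \<gamma>' \<delta>' where 2: "\<alpha>' * \<delta>' - \<beta>' * \<gamma>' = 1" "Q'' = act \<alpha>' \<beta>' \<gamma>' \<delta>' Q'" using assms(2) by (auto simp: sl2_equiv_def)
  have "(\<alpha> * \<alpha>' + \<beta> * \<gamma>') * (\<gamma> * \<beta>' + \<delta> * \<delta>') - (\<alpha> * \<beta>' + \<beta> * \<delta>') * (\<gamma> * \<alpha>' + \<delta> * \<gamma>') = (\<alpha> * \<delta> - \<beta> * \<gamma>) * (\<alpha>' * \<delta>' - \<beta>' * \<gamma>')"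
    by (simp add: algebra_simps)
  then show ?thesis using 1 2 by (intro sl2_equivI[of _ _ _ _ Q Q'']) (simp_all add: act_act)
qed

lemma sl2_equiv_sym: assumes "(Q, Q') \<in> sl2_equiv" shows "(Q', Q) \<in> sl2_equiv"
proof -
  obtain \<alpha> \<beta> \<gamma> \<delta> where 1: "\<alpha> * \<delta> - \<beta> * \<gamma> = 1" "Q' = act \<alpha> \<beta> \<gamma> \<delta> Q" using assms by (auto simp: sl2_equiv_def)
  have "act \<delta> (-\<beta>) (-\<gamma>) \<alpha> Q' = act (\<alpha> * \<delta> - \<beta> * \<gamma>) 0 0 (\<alpha> * \<delta> - \<beta> * \<gamma>) Q"
    unfolding 1(2) act_act by (simp add: algebra_simps)
  also have "\<dots> = Q" unfolding 1(1) by (cases Q) (simp add: act_def)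
  finally show ?thesis using 1(1) by (intro sl2_equivI) (auto simp: algebra_simps)
qed

lemma equiv_form_rel: "equiv (forms_disc N) (form_rel N)"
proof (rule equivI)
  show "form_rel N \<subseteq> forms_disc N \<times> forms_disc N" by auto
  show "refl_on (forms_disc N) (form_rel N)"
  proof (rule refl_onI)
    fix Q assume "Q \<in> forms_disc N"
    moreover have "(Q, Q) \<in> sl2_equiv" by (rule sl2_equivI[of 1 1 0 0]) (cases Q; simp add: act_def)+
    ultimately show "(Q, Q) \<in> form_rel N" by simp
  qed
  show "sym (form_rel N)" by (auto intro!: symI dest: sl2_equiv_sym)
  show "trans (form_rel N)" by (auto intro!: transI dest: sl2_equiv_trans)
qed

section \<open>Reduced forms: finiteness, existence and uniqueness\<close>

definition reduced :: "nat \<Rightarrow> qform set" where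
  "reduced N = {(a, b, c). (a, b, c) \<in> forms_disc N \<and> \<bar>b\<bar> \<le> a \<and> a \<le> c \<and> (\<bar>b\<bar> = a \<or> a = c \<longrightarrow> b \<ge> 0)}"

lemma finite_reduced: "finite (reduced N)"
proof (rule finite_subset)
  show "reduced N \<subseteq> {0..int N} \<times> {-int N..int N} \<times> {0..int N}"
  proof
    fix Q assume "Q \<in> reduced N"
    moreover obtain a b c where Q: "Q = (a, b, c)" by (cases Q)
    ultimately have "(a, b, c) \<in> reduced N" by simp
    then have h: "a > 0" "b^2 - 4 * a * c = - int N" "\<bar>b\<bar> \<le> a" "a \<le> c" by (auto simp: reduced_def in_forms_disc)
    have "b^2 = \<bar>b\<bar> * \<bar>b\<bar>" by (simp add: power2_eq_square)
    also have "\<dots> \<le> a * c" using h by (intro mult_mono) auto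
    finally have "b^2 \<le> a * c" .
    moreover have "1 * c \<le> a * c" using h by (intro mult_right_mono) auto
    ultimately have "c \<le> int N" using h by linarith
    then show "Q \<in> {0..int N} \<times> {-int N..int N} \<times> {0..int N}" using h Q by auto
  qed
qed simp

lemma exists_shift:
  fixes a b :: int assumes "a > 0" obtains k where "- a < b + 2 * a * k" "b + 2 * a * k \<le> a"
proof -
  define k where "k = - ((b + a - 1) div (2 * a))"
  have "b + a - 1 = 2 * a * ((b + a - 1) div (2 * a)) + (b + a - 1) mod (2 * a)" by simp
  moreover have "0 \<le> (b + a - 1) mod (2 * a)" "(b + a - 1) mod (2 * a) < 2 * a" using assms by simp_all
  ultimately show ?thesis using that[of k] unfolding k_def by (simp add: algebra_simps)
qed

text \<open>Minimise the leading coefficient a over the class and translate the middle coefficient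
  into (-a, a]. Exchanging the outer coefficients gives another form of the class, so minimality
  yields a \<le> c; the same exchange repairs the sign of b if a = c.\<close>

lemma exists_reduced:
  assumes Q: "Q \<in> forms_disc N"
  shows "\<exists>R\<in>reduced N. (Q, R) \<in> sl2_equiv"
proof -
  define P where "P n \<longleftrightarrow> (\<exists>R\<in>forms_disc N. (Q, R) \<in> sl2_equiv \<and> fst R = int n)" for n
  have refl: "(Q, Q) \<in> sl2_equiv" using equiv_form_rel[of N] Q by (auto simp: equiv_def refl_on_def)
  have "P (nat (fst Q))"
    unfolding P_def using Q refl by (cases Q) (auto simp: in_forms_disc intro!: bexI[of _ Q])
  define n where "n = (LEAST n. P n)"
  have "P n" unfolding n_def by (rule LeastI) fact
  have least: "n \<le> m" if "P m" for m unfolding n_def by (rule Least_le) fact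
  obtain a b c where R: "(a, b, c) \<in> forms_disc N" "(Q, (a, b, c)) \<in> sl2_equiv" "a = int n"
    using \<open>P n\<close> unfolding P_def by auto
  have a: "a > 0" using R by (auto simp: in_forms_disc)
  obtain k where k: "- a < b + 2 * a * k" "b + 2 * a * k \<le> a" using exists_shift[OF a] .
  define b' c' where "b' = b + 2 * a * k" and "c' = a * k^2 + b * k + c"
  have T: "act 1 k 0 1 (a, b, c) = (a, b', c')" by (simp add: act_def b'_def c'_def)
  have R': "(a, b', c') \<in> forms_disc N" using act_forms_disc[OF R(1), of 1 1 k 0] by (simp add: T)
  have eq: "(Q, (a, b', c')) \<in> sl2_equiv" by (rule sl2_equiv_trans[OF R(2) sl2_equivI[OF _ T]]) simp
  have S: "act 0 (-1) 1 0 (a, b', c') = (c', -b', a)" by (simp add: act_def)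
  have S': "(c', -b', a) \<in> forms_disc N" using act_forms_disc[OF R', of 0 0 "-1" 1] by (simp add: S)
  have eqS: "(Q, (c', -b', a)) \<in> sl2_equiv" by (rule sl2_equiv_trans[OF eq sl2_equivI[OF _ S]]) simp
  have "c' > 0" using S' by (simp add: in_forms_disc)
  then have "P (nat c')" unfolding P_def using S' eqS by (intro bexI[of _ "(c', -b', a)"]) auto
  then have ac: "a \<le> c'" using least[of "nat c'"] R(3) \<open>c' > 0\<close> by linarith
  show ?thesis
  proof (cases "a = c' \<and> b' < 0")
    case True
    then have "(c', -b', a) \<in> reduced N" using S' k unfolding reduced_def b'_def by auto
    then show ?thesis using eqS by blast
  next
    case False
    then have "(a, b', c') \<in> reduced N" using R' k ac unfolding reduced_def b'_def[symmetric] by auto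
    then show ?thesis using eq by blast
  qed
qed

lemma int_square_form_le_1:
  fixes x y :: int assumes "x \<ge> 0" "y \<ge> 0" "x^2 - x * y + y^2 \<le> 1"
  shows "x \<le> 1" "y \<le> 1"
proof -
  have *: "3 * v^2 \<le> 4" if "u^2 - u * v + v^2 \<le> 1" for u v :: int
  proof -
    have "3 * v^2 = 4 * (u^2 - u * v + v^2) - (2 * u - v)^2" by (simp add: power2_eq_square algebra_simps)
    also have "\<dots> \<le> 4 * 1 - 0" using that by (intro diff_mono mult_left_mono) auto
    finally show ?thesis by simp
  qed
  have "y^2 - y * x + x^2 \<le> 1" using assms(3) by (simp add: algebra_simps)
  from *[OF this] *[OF assms(3)]
have "y^2 < 2^2" "x^2 < 2^2" by auto
  then have "y < 2" "x < 2" using power2_less_imp_less[of y 2] power2_less_imp_less[of x 2] by simp_all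
  then show "x \<le> 1" "y \<le> 1" by auto
qed

text \<open>The form takes the value a' at (\<alpha>, \<gamma>), which is at least a times
  \<open>\<alpha>^2 - \<bar>\<alpha> * \<gamma>\<bar> + \<gamma>^2\<close>. So \<alpha> and \<gamma>
  are at most 1 in absolute value. The cases are a translation, an exchange of equal outer
  coefficients followed by a translation, and the corner a = b = c.\<close>

lemma reduced_unique_aux:
  assumes R: "(a, b, c) \<in> reduced N" and R': "(a', b', c') \<in> reduced N"
    and eq: "((a, b, c), (a', b', c')) \<in> sl2_equiv" and le: "a' \<le> a"
  shows "(a, b, c) = (a', b', c')"
proof -
  have r: "a > 0" "\<bar>b\<bar> \<le> a" "a \<le> c" "\<bar>b\<bar> = a \<or> a = c \<longrightarrow> b \<ge> 0" "b^2 - 4 * a * c = - int N"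
    using R by (auto simp: reduced_def in_forms_disc)
  have r': "a' > 0" "\<bar>b'\<bar> \<le> a'" "a' \<le> c'" "\<bar>b'\<bar> = a' \<or> a' = c' \<longrightarrow> b' \<ge> 0" "b'^2 - 4 * a' * c' = - int N"
    using R' by (auto simp: reduced_def in_forms_disc)
  obtain \<alpha> \<beta> \<gamma> \<delta> where det: "\<alpha> * \<delta> - \<beta> * \<gamma> = 1" and act: "act \<alpha> \<beta> \<gamma> \<delta> (a, b, c) = (a', b', c')"
    using eq by (auto simp: sl2_equiv_def)
  have a': "a' = a * \<alpha>^2 + b * \<alpha> * \<gamma> + c * \<gamma>^2"
    and b': "b' = 2 * a * \<alpha> * \<beta> + b * (\<alpha> * \<delta> + \<beta> * \<gamma>) + 2 * c * \<gamma> * \<delta>" using act by (auto simp: act_def)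
  have "a * (\<bar>\<alpha>\<bar>^2 - \<bar>\<alpha>\<bar> * \<bar>\<gamma>\<bar> + \<bar>\<gamma>\<bar>^2) \<le> a'"
  proof -
    have "\<bar>b * (\<alpha> * \<gamma>)\<bar> \<le> a * (\<bar>\<alpha>\<bar> * \<bar>\<gamma>\<bar>)"
      unfolding abs_mult using r by (intro mult_right_mono) auto
    moreover have "a * \<gamma>^2 \<le> c * \<gamma>^2" using r by (intro mult_right_mono) auto
    ultimately show ?thesis unfolding a' by (simp add: algebra_simps abs_le_iff)
  qed
  then have "a * (\<bar>\<alpha>\<bar>^2 - \<bar>\<alpha>\<bar> * \<bar>\<gamma>\<bar> + \<bar>\<gamma>\<bar>^2) \<le> a * 1" using le by simp
  then have "\<bar>\<alpha>\<bar>^2 - \<bar>\<alpha>\<bar> * \<bar>\<gamma>\<bar> + \<bar>\<gamma>\<bar>^2 \<le> 1" using r(1) by (rule mult_left_le_imp_le)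
  then have small: "\<bar>\<alpha>\<bar> \<le> 1" "\<bar>\<gamma>\<bar> \<le> 1" using int_square_form_le_1[of "\<bar>\<alpha>\<bar>" "\<bar>\<gamma>\<bar>"] by auto
  have fin: ?thesis if "a = a'" "b = b'"
  proof -
    have "b^2 - 4 * a * c = b^2 - 4 * a * c'" using r(5) r'(5) unfolding that[symmetric] by simp
    then have "a * c = a * c'" by simp
    then show ?thesis using that r(1) by simp
  qed
  have unit: "x = 1 \<or> x = -1" if "x * y = 1" for x y :: int
    using that zmult_eq_1_iff by blast
  show ?thesis
  proof (cases "\<gamma> = 0")
    case True
    then have \<alpha>\<delta>: "\<alpha> * \<delta> = 1" using det by simp
    then have \<alpha>: "\<alpha> = 1 \<or> \<alpha> = -1" by (rule unit)
    have aa: "a' = a" using \<alpha> unfolding a' True by auto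
    have bb: "b' = b + 2 * a * (\<alpha> * \<beta>)" unfolding b' using True \<alpha>\<delta> by simp
    define k where "k = \<alpha> * \<beta>"
    have "k = 0"
    proof (rule ccontr)
      assume "k \<noteq> 0"
      then consider "k \<ge> 1" | "k \<le> -1" by linarith
      then show False
      proof cases
        case 1
        then have "2 * a * 1 \<le> 2 * a * k" using r(1) by (intro mult_left_mono) auto
        then show False using bb r r' aa unfolding k_def[symmetric] by linarith
      next
        case 2
        then have "2 * a * k \<le> 2 * a * (-1)" using r(1) by (intro mult_left_mono) auto
        then show False using bb r r' aa unfolding k_def[symmetric] by linarith
      qed
    qed
    then show ?thesis using fin aa bb by (simp add: k_def)
  next
    case \<gamma>: False
    then have \<gamma>1: "\<gamma> = 1 \<or> \<gamma> = -1" using small by linarith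
    show ?thesis
    proof (cases "\<alpha> = 0")
      case True
      have "- \<beta> * \<gamma> = 1" using det True by simp
      then have bg: "\<beta> * \<gamma> = -1" by simp
      have ac: "a' = c" unfolding a' True using \<gamma>1 by auto
      then have "a = c" using le r by simp
      then have b0: "b \<ge> 0" using r by simp
      define k where "k = \<gamma> * \<delta>"
      have bb: "b' = - b + 2 * a * k" unfolding b' True bg k_def using \<open>a = c\<close> bg by (simp add: algebra_simps)
      have k2: "k \<le> 1"
      proof (rule ccontr)
        assume "\<not> k \<le> 1"
        then have "2 * a * 2 \<le> 2 * a * k" using r(1) by (intro mult_left_mono) auto
        then show False using bb r r' ac \<open>a = c\<close> by linarith
      qed
      have k1: "k \<ge> 0"
      proof (rule ccontr)
        assume "\<not> k \<ge> 0"
        then have "2 * a * k \<le> 2 * a * (-1)" using r(1) by (intro mult_left_mono) auto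
        then show False using bb r r' ac \<open>a = c\<close> b0 by linarith
      qed
      show ?thesis
      proof (cases "k = 0")
        case True
        then have "b' = - b" using bb by simp
        then have "b'^2 = b^2" by simp
        moreover have "a' = a" using ac \<open>a = c\<close> by simp
        ultimately have "b^2 - 4 * a * c = b^2 - 4 * a * c'" using r(5) r'(5) by simp
        then have "c' = a'" using ac r(1) \<open>a = c\<close> by simp
        then have "b' \<ge> 0" using r' by simp
        then show ?thesis using fin b0 bb True ac \<open>a = c\<close> by simp
      next
        case False
        then have "k = 1" using k1 k2 by simp
        then have "b' = 2 * a - b" using bb by simp
        then show ?thesis using fin r r' ac \<open>a = c\<close> by linarith
      qed
    next
      case False
      then have \<alpha>1: "\<alpha> = 1 \<or> \<alpha> = -1" using small by linarith
      have "a' = a + b * (\<alpha> * \<gamma>) + c" unfolding a' using \<alpha>1 \<gamma>1 by auto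
      moreover have "\<alpha> * \<gamma> = 1 \<or> \<alpha> * \<gamma> = -1" using \<alpha>1 \<gamma>1 by auto
      ultimately have "a' = a + b + c \<or> a' = a - b + c" by auto
      then have ab: "a = c" "b = a" "a' = a" using le r by linarith+
      have "a * (4 * c') = a * (3 * a) + b'^2" using r(5) r'(5) ab by (simp add: power2_eq_square algebra_simps)
      moreover have "b'^2 \<le> a * a" using r'(2) ab(3) abs_le_square_iff[of b' a] r(1) by (simp add: power2_eq_square)
      ultimately have "a * (4 * c') \<le> a * (4 * a)" by (simp add: algebra_simps)
      then have "4 * c' \<le> 4 * a" using r(1) by (rule mult_left_le_imp_le)
      then have "c' = a" using r' ab by simp
      then have "b'^2 = a^2" "b' \<ge> 0" using r(5) r'(5) r' ab by (auto simp: power2_eq_square)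
      then have "b' = a" using r(1) by (simp add: power2_eq_iff)
      then show ?thesis using fin ab by simp
    qed
  qed
qed

lemma reduced_unique:
  assumes "R \<in> reduced N" "R' \<in> reduced N" "(R, R') \<in> sl2_equiv" shows "R = R'"
proof -
  obtain a b c a' b' c' where e: "R = (a, b, c)" "R' = (a', b', c')" by (cases R, cases R')
  show ?thesis
  proof (cases "a' \<le> a")
    case True then show ?thesis using reduced_unique_aux[of a b c N a' b' c'] assms e by simp
  next
    case False then show ?thesis using reduced_unique_aux[of a' b' c' N a b c] sl2_equiv_sym[OF assms(3)] assms e by simp
  qed
qed

section \<open>Class numbers as weighted counts of reduced forms\<close>

definition form_weight :: "qform \<Rightarrow> int" where
  "form_weight Q = (case Q of (a, b, c) \<Rightarrow> if b = 0 \<and> a = c then 3 else if a = b \<and> b = c then 2 else 6)"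

lemma hurwitz_eq_sum_reduced:
  assumes "N > 0" "N mod 4 = 0 \<or> N mod 4 = 3"
  shows "6 * hurwitz N = real_of_int (\<Sum>R\<in>reduced N. form_weight R)"
proof -
  let ?cl = "\<lambda>R. form_rel N `` {R}"
  have sub: "R \<in> forms_disc N" if "R \<in> reduced N" for R using that by (auto simp: reduced_def)
  have "inj_on ?cl (reduced N)"
  proof (rule inj_onI)
    fix R R' assume h: "R \<in> reduced N" "R' \<in> reduced N" "?cl R = ?cl R'"
    then have "(R, R') \<in> form_rel N" using eq_equiv_class[OF h(3) equiv_form_rel] sub by blast
    then show "R = R'" using reduced_unique h by blast
  qed
  moreover have "?cl ` reduced N = form_classes N"
  proof (intro equalityI subsetI)
    fix X assume "X \<in> ?cl ` reduced N"
    then show "X \<in> form_classes N" unfolding form_classes_def by (auto intro!: quotientI dest: sub)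
  next
    fix X assume "X \<in> form_classes N"
    then obtain Q where Q: "Q \<in> forms_disc N" "X = ?cl Q" unfolding form_classes_def by (auto elim: quotientE)
    obtain R where R: "R \<in> reduced N" "(Q, R) \<in> sl2_equiv" using exists_reduced[OF Q(1)] by blast
    then have "?cl Q = ?cl R" using Q sub by (intro equiv_class_eq[OF equiv_form_rel]) auto
    then show "X \<in> ?cl ` reduced N" using R Q by blast
  qed
  ultimately have "(\<Sum>C\<in>form_classes N. class_weight C) = (\<Sum>R\<in>reduced N. class_weight (?cl R))"
    by (metis (no_types, lifting) sum.reindex_cong)
  also have "\<dots> = (\<Sum>R\<in>reduced N. real_of_int (form_weight R) / 6)"
  proof (rule sum.cong)
    fix R assume R: "R \<in> reduced N"
    obtain a b c where Req: "R = (a, b, c)" by (cases R)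
    \<comment> \<open>The forms (k, 0, k) and (k, k, k) of the right discriminant are reduced
      themselves, so by uniqueness a class contains one only as its own reduced form.\<close>
    have mem: "R' \<in> ?cl R \<longleftrightarrow> R' = R" if "R' \<in> forms_disc N \<longrightarrow> R' \<in> reduced N" for R'
    proof
      assume "R' \<in> ?cl R" then show "R' = R" using reduced_unique[OF R, of R'] that by auto
    next
      assume "R' = R" then show "R' \<in> ?cl R" using equiv_class_self[OF equiv_form_rel sub[OF R]] by simp
    qed
    have "(k, 0, k) \<in> ?cl R \<longleftrightarrow> (k, 0, k) = R" for k
      by (rule mem) (auto simp: reduced_def in_forms_disc)
    moreover have "(k, k, k) \<in> ?cl R \<longleftrightarrow> (k, k, k) = R" for k
      by (rule mem) (auto simp: reduced_def in_forms_disc)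
    ultimately show "class_weight (?cl R) = real_of_int (form_weight R) / 6"
      unfolding class_weight_def form_weight_def Req by auto
  qed simp
  finally show ?thesis
    using assms unfolding hurwitz_def by (auto simp: sum_divide_distrib[symmetric])
qed

section \<open>Class numbers as weighted counts over the ideal triangle\<close>

fun rotate_form :: "qform \<Rightarrow> qform" where "rotate_form (a, b, c) = (a + b + c, - 2 * a - b, a)"

text \<open>Twice the indicator function of the root lying in the ideal triangle, where boundary points count one half.\<close>
fun delta_weight :: "qform \<Rightarrow> int" where
  "delta_weight (a, b, c) = sgn (- b) + sgn (b + 2 * c) + sgn (2 * a + b) - 1"

text \<open>Selects one form from each orbit of the rotation, except for the multiples of \<open>x\<^sup>2 - x y + y\<^sup>2\<close>, which are its
  fixed points.\<close>
fun delta_rep :: "qform \<Rightarrow> bool" where "delta_rep (a, b, c) \<longleftrightarrow> a < c \<and> 0 \<le> b + c"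

lemma forms_disc_pos:
  assumes "(a, b, c) \<in> forms_disc N"
  shows "a > 0" "c > 0" "a + b + c > 0"
proof -
  have h: "a > 0" "b^2 < 4 * a * c" using assms by (auto simp: in_forms_disc)
  show "a > 0" by fact
  have "4 * a * c > 0" using h zero_le_power2[of b] by linarith
  then show "c > 0" using h by (simp add: zero_less_mult_iff)
  have "4 * a * (a + b + c) = (2 * a + b)^2 + (4 * a * c - b^2)" by (simp add: power2_eq_square algebra_simps)
  also have "\<dots> > 0" using h zero_le_power2[of "2 * a + b"] by linarith
  finally show "a + b + c > 0" using h by (simp add: zero_less_mult_iff)
qed

text \<open>The rotation is the substitution \<open>act 1 (-1) 1 0\<close>, whose cube is -1. It
  permutes the values a, c, a + b + c of the form cyclically.\<close>

lemma rotate_form_cube: "rotate_form (rotate_form (rotate_form Q)) = Q"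
  by (cases Q) simp

lemma rotate_form_forms_disc: "Q \<in> forms_disc N \<Longrightarrow> rotate_form Q \<in> forms_disc N"
  using forms_disc_pos[of "fst Q" "fst (snd Q)" "snd (snd Q)" N]
  by (cases Q) (auto simp: in_forms_disc power2_eq_square algebra_simps)

lemma bij_rotate_form: "bij_betw rotate_form (forms_disc N) (forms_disc N)"
  by (rule bij_betw_byWitness[where f' = "\<lambda>Q. rotate_form (rotate_form Q)"])
     (auto simp del: rotate_form.simps simp: rotate_form_cube rotate_form_forms_disc)

lemma delta_weight_rotate: "delta_weight (rotate_form Q) = delta_weight Q"
  by (cases Q) (simp add: add.commute)

text \<open>As in \<open>selling_bounds\<close>: a nonzero weight forces the Selling parameters -b,
  \<open>b + 2 * c\<close>, \<open>2 * a + b\<close> to be nonnegative, and their pairwise products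
  add up to N.\<close>

lemma fin_supp_delta_weight: "fin_supp (forms_disc N) delta_weight"
proof (rule fin_suppI)
  define m where "m = 4 * int N + 4"
  show "finite ({0..m} \<times> {-m..m} \<times> {0..m})" by simp
  fix Q assume Q: "Q \<in> forms_disc N" "delta_weight Q \<noteq> 0"
  obtain a b c where Qeq: "Q = (a, b, c)" by (cases Q)
  have pos: "a > 0" "c > 0" "a + b + c > 0" using forms_disc_pos Q unfolding Qeq by blast+
  have eq: "b^2 - 4 * a * c = - int N" using Q unfolding Qeq by (simp add: in_forms_disc)
  have ne: "sgn (- b) + sgn (2 * a + b) + sgn (b + 2 * c) \<noteq> 1" using Q unfolding Qeq by simp
  have P: "- b \<ge> 0" "2 * a + b \<ge> 0" "b + 2 * c \<ge> 0"
    using ne pos int_sign_cases[of "-b"] int_sign_cases[of "2 * a + b"] int_sign_cases[of "b + 2 * c"] by linarith+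
  have N: "(- b) * (2 * a + b) + (- b) * (b + 2 * c) + (2 * a + b) * (b + 2 * c) = int N"
    using eq by (simp add: algebra_simps power2_eq_square)
  have nn: "(- b) * (2 * a + b) \<ge> 0" "(- b) * (b + 2 * c) \<ge> 0" "(2 * a + b) * (b + 2 * c) \<ge> 0"
    by (simp_all only: mult_nonneg_nonneg P)
  have key: "u \<le> int N" if "u * v + u * w \<le> int N" "v + w \<ge> 2" "u \<ge> 0" for u v w :: int
  proof -
    have "u * 1 \<le> u * (v + w)" using that by (intro mult_left_mono) auto
    then show ?thesis using that(1) by (simp add: distrib_left)
  qed
  have "- b \<le> int N" using key[of "-b" "2 * a + b" "b + 2 * c"] N nn P pos by linarith
  moreover have "2 * a + b \<le> int N"
    using key[of "2 * a + b" "-b" "b + 2 * c"] N nn P pos unfolding mult.commute[of "2 * a + b" "- b"] by linarith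
  moreover have "b + 2 * c \<le> int N"
    using key[of "b + 2 * c" "-b" "2 * a + b"] N nn P pos unfolding mult.commute[of "b + 2 * c"] by linarith
  ultimately show "Q \<in> {0..m} \<times> {-m..m} \<times> {0..m}"
    using P pos unfolding Qeq m_def by simp
qed

text \<open>\<open>delta_rep\<close> says that a is the least of the values a, c, a + b + c. One
  strict and one weak inequality break ties, unless all three values are equal.\<close>

lemma sum_delta_rep:
  "of_bool (delta_rep Q) + of_bool (delta_rep (rotate_form Q)) + of_bool (delta_rep (rotate_form (rotate_form Q)))
   + of_bool (case Q of (a, b, c) \<Rightarrow> a = c \<and> b = - c) = (1 :: int)"
  by (cases Q) auto

lemma fsum_delta_weight_split:
  "fsum (forms_disc N) delta_weight = 3 * fsum (forms_disc N) (\<lambda>Q. of_bool (delta_rep Q) * delta_weight Q)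
     + fsum (forms_disc N) (\<lambda>Q. of_bool (case Q of (a, b, c) \<Rightarrow> a = c \<and> b = - c) * delta_weight Q)"
proof -
  let ?X = "forms_disc N"
  let ?f = "\<lambda>Q. of_bool (delta_rep Q) * delta_weight Q"
  let ?g = "\<lambda>Q. of_bool (case Q of (a, b, c) \<Rightarrow> a = c \<and> b = - c) * delta_weight Q"
  note fin = fin_supp_mult[OF fin_supp_delta_weight[of N]]
  have f1: "fin_supp ?X (\<lambda>Q. ?f (rotate_form Q))"
    using fin_supp_bij[OF bij_rotate_form, of N ?f] fin by simp
  have f2: "fin_supp ?X (\<lambda>Q. ?f (rotate_form (rotate_form Q)))"
    using fin_supp_bij[OF bij_rotate_form, of N "\<lambda>Q. ?f (rotate_form Q)"] f1 by simp
  have s1: "fsum ?X (\<lambda>Q. ?f (rotate_form Q)) = fsum ?X ?f" by (rule fsum_bij[OF bij_rotate_form])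
  have s2: "fsum ?X (\<lambda>Q. ?f (rotate_form (rotate_form Q))) = fsum ?X ?f"
    using fsum_bij[OF bij_rotate_form, of N "\<lambda>Q. ?f (rotate_form Q)"] s1 by simp
  have "fsum ?X delta_weight = fsum ?X (\<lambda>Q. ?f Q + ?f (rotate_form Q) + ?f (rotate_form (rotate_form Q)) + ?g Q)"
    by (rule fsum_cong) (simp only: delta_weight_rotate distrib_right[symmetric] sum_delta_rep mult_1_left)
  also have "\<dots> = 3 * fsum ?X ?f + fsum ?X ?g"
    by (simp only: fsum_add[OF fin_supp_add[OF fin_supp_add[OF fin f1] f2] fin] fsum_add[OF fin_supp_add[OF fin f1] f2]
         fsum_add[OF fin f1] s1 s2)
  finally show ?thesis .
qed

lemma reduced_iff:
  "(a, b, c) \<in> reduced N \<longleftrightarrow> (a, b, c) \<in> forms_disc N \<and> \<bar>b\<bar> \<le> a \<and> a \<le> c \<and> (\<bar>b\<bar> = a \<or> a = c \<longrightarrow> b \<ge> 0)"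
  by (auto simp: reduced_def)

text \<open>At (a, -a, a) all three signs are 1, so the weight is 2. Such a form is a translate of
  the reduced form (a, a, a).\<close>

lemma fsum_delta_corner:
  "fsum (forms_disc N) (\<lambda>Q. of_bool (case Q of (a, b, c) \<Rightarrow> a = c \<and> b = - c) * delta_weight Q) =
   (\<Sum>(a, b, c)\<in>reduced N. if a = b \<and> b = c then 2 else 0)"
proof -
  let ?Z = "{(a, b, c)\<in>reduced N. a = b \<and> b = c}"
  let ?h = "\<lambda>(a, b, c). (a, - b, c) :: qform"
  let ?g = "\<lambda>Q. of_bool (case Q of (a, b, c) \<Rightarrow> a = c \<and> b = - c) * delta_weight Q"
  have fin: "finite ?Z" by (rule finite_subset[OF _ finite_reduced[of N]]) auto
  have "fsum (forms_disc N) ?g = sum ?g (?h ` ?Z)"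
  proof (rule fsum_eq_sum)
    show "finite (?h ` ?Z)" using fin by simp
    show "?h ` ?Z \<subseteq> forms_disc N" by (auto simp: reduced_def in_forms_disc)
    fix Q assume Q: "Q \<in> forms_disc N" "?g Q \<noteq> 0"
    then obtain a where a: "Q = (a, - a, a)" by (cases Q) (auto split: if_splits)
    then have "(a, a, a) \<in> ?Z" using Q by (auto simp: reduced_def in_forms_disc)
    then show "Q \<in> ?h ` ?Z" using a by (auto intro!: image_eqI[of _ _ "(a, a, a)"])
  qed
  also have "\<dots> = (\<Sum>Q\<in>?Z. ?g (?h Q))"
    by (subst sum.reindex) (auto simp: inj_on_def)
  also have "\<dots> = (\<Sum>Q\<in>?Z. 2)"
  proof (rule sum.cong)
    fix Q assume "Q \<in> ?Z"
    then obtain a where "Q = (a, a, a)" "a > 0" by (auto simp: reduced_def in_forms_disc)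
    then show "?g (?h Q) = 2" by simp
  qed simp
  also have "\<dots> = (\<Sum>Q\<in>reduced N. case Q of (a, b, c) \<Rightarrow> if a = b \<and> b = c then 2 else 0)"
    by (rule sum.mono_neutral_cong_left[OF finite_reduced]) (auto split: if_splits)
  finally show ?thesis .
qed

text \<open>A reduced form is hit by itself if its middle coefficient is at most 0 and by a translate if it is at least 0.\<close>
lemma fsum_delta_rep:
  "fsum (forms_disc N) (\<lambda>Q. of_bool (delta_rep Q) * delta_weight Q) =
   (\<Sum>(a, b, c)\<in>reduced N. if b = 0 \<and> a = c then 1 else if a = b \<and> b = c then 0 else 2)"
proof -
  let ?g = "\<lambda>Q. of_bool (delta_rep Q) * delta_weight Q"
  \<comment> \<open>The root lies on the boundary exactly if b = 0 in the reduced form: on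
    \<open>A1\<close> the parameter \<open>- b\<close> vanishes, and after the translation
    \<open>h\<close> of \<open>A3\<close> onto \<open>A2\<close> it is
    \<open>2 * a + b\<close>.\<close>
  let ?w = "\<lambda>(a :: int, b :: int, c :: int). if b = 0 then 1 else 2 :: int"
  define A1 where "A1 = {(a, b, c)\<in>reduced N. a < c \<and> b \<le> 0}"
  define A2 where "A2 = {(a, b, c)\<in>forms_disc N. - 2 * a \<le> b \<and> b \<le> - a \<and> a < c \<and> 0 \<le> b + c}"
  define A3 where "A3 = {(a, b, c)\<in>reduced N. 0 \<le> b \<and> \<not> (a = b \<and> b = c)}"
  define h :: "qform \<Rightarrow> qform" where "h = (\<lambda>(a, b, c). (a, b - 2 * a, a - b + c))"
  have fin1: "finite A1" by (rule finite_subset[OF _ finite_reduced[of N]]) (auto simp: A1_def)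
  have fin3: "finite A3" by (rule finite_subset[OF _ finite_reduced[of N]]) (auto simp: A3_def)
  have inj: "inj_on h A3" by (auto simp: inj_on_def h_def)
  have A2: "A2 = h ` A3"
  proof (intro equalityI subsetI)
    fix Q assume "Q \<in> A2"
    then obtain a b c where Q: "Q = (a, b, c)" "(a, b, c) \<in> forms_disc N" "- 2 * a \<le> b" "b \<le> - a" "a < c" "0 \<le> b + c"
      by (auto simp: A2_def)
    have "(a, b + 2 * a, a + b + c) \<in> forms_disc N"
      using Q(2) by (auto simp: in_forms_disc power2_eq_square algebra_simps)
    then have "(a, b + 2 * a, a + b + c) \<in> A3" using Q forms_disc_pos[OF Q(2)] by (auto simp: A3_def reduced_iff)
    moreover have "h (a, b + 2 * a, a + b + c) = Q" by (simp add: h_def Q)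
    ultimately show "Q \<in> h ` A3" by (metis imageI)
  next
    fix Q assume "Q \<in> h ` A3"
    then obtain a b c where Q: "Q = (a, b - 2 * a, a - b + c)" "(a, b, c) \<in> reduced N" "0 \<le> b" "\<not> (a = b \<and> b = c)"
      by (auto simp: A3_def h_def)
    then have r: "(a, b, c) \<in> forms_disc N" "\<bar>b\<bar> \<le> a" "a \<le> c" by (auto simp: reduced_iff)
    then have "(a, b - 2 * a, a - b + c) \<in> forms_disc N"
      by (auto simp: in_forms_disc power2_eq_square algebra_simps)
    then show "Q \<in> A2" using Q r by (auto simp: A2_def)
  qed
  have "fsum (forms_disc N) ?g = sum ?g (A1 \<union> A2)"
  proof (rule fsum_eq_sum)
    show "finite (A1 \<union> A2)" using fin1 fin3 A2 by simp
    show "A1 \<union> A2 \<subseteq> forms_disc N" by (auto simp: A1_def A2_def reduced_def)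
    fix Q assume Q: "Q \<in> forms_disc N" "?g Q \<noteq> 0"
    obtain a b c where Qeq: "Q = (a, b, c)" by (cases Q)
    have d: "a < c" "0 \<le> b + c" using Q(2) by (auto simp: Qeq split: if_splits)
    have pos: "a > 0" using Q(1) by (simp add: Qeq in_forms_disc)
    have "delta_weight Q \<noteq> 0" using Q(2) by auto
    then have ne: "sgn (- b) + sgn (2 * a + b) + sgn (b + 2 * c) \<noteq> 1" by (simp add: Qeq)
    have "- b \<ge> 0" "2 * a + b \<ge> 0"
      using ne d pos int_sign_cases[of "-b"] int_sign_cases[of "2 * a + b"] int_sign_cases[of "b + 2 * c"] by linarith+
    then show "Q \<in> A1 \<union> A2" using Q(1) d pos unfolding Qeq A1_def A2_def by (auto simp: reduced_iff)
  qed
  also have "\<dots> = sum ?g A1 + sum ?g A2"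
  proof (rule sum.union_disjoint)
    show "A1 \<inter> A2 = {}" by (auto simp: A1_def A2_def reduced_iff dest: forms_disc_pos(1))
  qed (use fin1 fin3 A2 in simp_all)
  also have "sum ?g A1 = sum ?w A1"
  proof (rule sum.cong)
    fix Q assume "Q \<in> A1"
    then obtain a b c where Q: "Q = (a, b, c)" "(a, b, c) \<in> reduced N" "a < c" "b \<le> 0" by (auto simp: A1_def)
    then have "(a, b, c) \<in> forms_disc N" "- a < b" by (auto simp: reduced_iff dest: forms_disc_pos(1))
    then have "a > 0" by (simp add: in_forms_disc)
    then show "?g Q = ?w Q" using Q \<open>- a < b\<close> by (auto simp: sgn_if)
  qed simp
  also have "sum ?w A1 = (\<Sum>Q\<in>reduced N. case Q of (a, b, c) \<Rightarrow> if a < c \<and> b \<le> 0 then (if b = 0 then 1 else 2) else 0)"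
    by (rule sum.mono_neutral_cong_left[OF finite_reduced]) (auto simp: A1_def split: if_splits)
  also have "sum ?g A2 = (\<Sum>Q\<in>A3. ?g (h Q))" unfolding A2 by (simp add: sum.reindex[OF inj])
  also have "\<dots> = sum ?w A3"
  proof (rule sum.cong)
    fix Q assume "Q \<in> A3"
    then obtain a b c where Q: "Q = (a, b, c)" "(a, b, c) \<in> reduced N" "0 \<le> b" "\<not> (a = b \<and> b = c)" by (auto simp: A3_def)
    then have r: "(a, b, c) \<in> forms_disc N" "\<bar>b\<bar> \<le> a" "a \<le> c" by (auto simp: reduced_iff)
    then have "a > 0" by (simp add: in_forms_disc)
    then show "?g (h Q) = ?w Q" using Q r by (auto simp: h_def sgn_if)
  qed simp
  also have "sum ?w A3 = (\<Sum>Q\<in>reduced N. case Q of (a, b, c) \<Rightarrow> if 0 \<le> b \<and> \<not> (a = b \<and> b = c) then (if b = 0 then 1 else 2) else 0)"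
    by (rule sum.mono_neutral_cong_left[OF finite_reduced]) (auto simp: A3_def split: if_splits)
  finally have "fsum (forms_disc N) ?g = (\<Sum>Q\<in>reduced N. (case Q of (a, b, c) \<Rightarrow> if a < c \<and> b \<le> 0 then (if b = 0 then 1 else 2) else 0)
     + (case Q of (a, b, c) \<Rightarrow> if 0 \<le> b \<and> \<not> (a = b \<and> b = c) then (if b = 0 then 1 else 2) else 0))"
    by (simp only: sum.distrib)
  also have "\<dots> = (\<Sum>(a, b, c)\<in>reduced N. if b = 0 \<and> a = c then 1 else if a = b \<and> b = c then 0 else 2)"
    by (rule sum.cong) (auto simp: reduced_iff in_forms_disc)
  finally show ?thesis .
qed

text \<open>Three times the values 1, 0, 2 of \<open>fsum_delta_rep\<close> together with the corner
  term 2 give the weights 3, 2, 6 of \<open>form_weight\<close>.\<close>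

lemma hurwitz_eq_fsum:
  assumes "N > 0" "N mod 4 = 0 \<or> N mod 4 = 3"
  shows "6 * hurwitz N = real_of_int (fsum (forms_disc N) delta_weight)"
proof -
  have "fsum (forms_disc N) delta_weight = (\<Sum>R\<in>reduced N. form_weight R)"
    unfolding fsum_delta_weight_split fsum_delta_corner fsum_delta_rep sum_distrib_left sum.distrib[symmetric]
    by (rule sum.cong) (auto simp: form_weight_def reduced_iff in_forms_disc)
  then show ?thesis using hurwitz_eq_sum_reduced[OF assms] by simp
qed

subsection \<open>Sums of class numbers\<close>

definition traces :: "int \<Rightarrow> int set" where "traces p = {r. r^2 < 4 * p}"

lemma finite_traces: "finite (traces p)"
proof (rule finite_subset)
  show "traces p \<subseteq> {- (4 * p)..4 * p}"
  proof
    fix r assume "r \<in> traces p"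
    then have "r^2 < 4 * p" by (simp add: traces_def)
    moreover have "\<bar>r\<bar> * 1 \<le> \<bar>r\<bar> * \<bar>r\<bar>" by (cases "r = 0") (auto intro!: mult_left_mono simp del: mult_1_right abs_mult_self_eq)
    ultimately have "\<bar>r\<bar> \<le> 4 * p" by (simp add: power2_eq_square)
    then show "r \<in> {- (4 * p)..4 * p}" by auto
  qed
qed simp

section \<open>Correspondence between matrices and pairs of a trace and a form\<close>

lemma tr_conjU: "tr (conjU M) = tr M"
  by (cases M) simp

fun mat_neg :: "mat2 \<Rightarrow> mat2" where "mat_neg (A, B, C, D) = (- A, - B, - C, - D)"

lemma bij_mat_neg: "bij_betw mat_neg (mats p) (mats p)"
  by (rule bij_betw_byWitness[where f' = mat_neg]) (auto simp: mats_def)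

lemma tau_neg: "tau (mat_neg M) = tau M"
proof (cases M)
  case (fields A B C D)
  have "- C * (- A - - D) = C * (A - D)" "(- A + - D) * (- B + - C) = (A + D) * (B + C)"
    by (simp_all add: algebra_simps)
  then show ?thesis unfolding fields mat_neg.simps tau.simps by simp
qed

lemma cyc_tau_neg: "cyc tau (mat_neg M) = cyc tau M"
proof -
  have "conjU (mat_neg M) = mat_neg (conjU M)" for M by (cases M) simp
  then show ?thesis by (simp add: cyc_def tau_neg)
qed

lemma some_zero_neg: "some_zero (mat_neg M) = some_zero M"
  by (cases M) auto

text \<open>M and -M contribute equally, so it suffices to double the part with C > 0. There M
  corresponds to its trace and the form (C, D - A, -B), and a nonzero weight forces this form to be
  positive definite.\<close>

lemma sum_traces_eq_fsum:
  assumes p: "prime p" and f: "\<And>r. f (- r) = f r"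
  shows "fsum (mats p) (\<lambda>M. f (tr M) * of_bool (\<not> some_zero M) * cyc tau M) =
    2 * (\<Sum>r\<in>traces p. f r * fsum (forms_disc (nat (4 * p - r^2))) delta_weight)"
proof -
  have p0: "p > 0" using p by (simp add: prime_gt_0_int)
  let ?F = "\<lambda>M. f (tr M) * of_bool (\<not> some_zero M) * cyc tau M"
  let ?H = "\<lambda>M. of_bool (fst (snd (snd M)) > 0) * ?F M"
  let ?Hn = "\<lambda>M. of_bool (fst (snd (snd M)) < 0) * ?F M"
  have finF: "fin_supp (mats p) ?F" by (intro fin_supp_mult fin_supp_cyc_tau p)
  have F_neg: "?F (mat_neg M) = ?F M" for M
  proof -
    have "tr (mat_neg M) = - tr M" by (cases M) simp
    then show ?thesis using f by (simp add: cyc_tau_neg some_zero_neg)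
  qed
  have "fsum (mats p) ?F = fsum (mats p) (\<lambda>M. ?H M + ?Hn M)"
    by (rule fsum_cong) (auto split: if_splits)
  also have "\<dots> = fsum (mats p) ?H + fsum (mats p) ?Hn"
    by (rule fsum_add) (rule fin_supp_mult[OF finF])+
  also have "fsum (mats p) ?Hn = fsum (mats p) (\<lambda>M. ?Hn (mat_neg M))"
    by (rule fsum_bij[OF bij_mat_neg, symmetric])
  also have "\<dots> = fsum (mats p) ?H"
  proof (rule fsum_cong)
    fix M :: mat2
    have "fst (snd (snd (mat_neg M))) = - fst (snd (snd M))" by (cases M) simp
    then show "?Hn (mat_neg M) = ?H M" using F_neg[of M] by simp
  qed
  finally have two: "fsum (mats p) ?F = 2 * fsum (mats p) ?H" by simp

  define Y where "Y r = {Q\<in>forms_disc (nat (4 * p - r^2)). delta_weight Q \<noteq> 0}" for r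
  \<comment> \<open>The inverse of passing from M to its trace and form. The divisions are exact
    because \<open>b^2\<close> and \<open>r^2\<close> are congruent modulo 4.\<close>
  define \<Phi> :: "int \<times> qform \<Rightarrow> mat2" where "\<Phi> = (\<lambda>(r, a, b, c). ((r - b) div 2, - c, a, (r + b) div 2))"
  have finY: "finite (Y r)" for r using fin_supp_delta_weight[of "nat (4 * p - r^2)"] by (simp add: Y_def fin_supp_def)
  have inv: "\<exists>A D. \<Phi> (r, a, b, c) = (A, - c, a, D) \<and> r = A + D \<and> b = D - A \<and> A * D + a * c = p"
    if "r \<in> traces p" "(a, b, c) \<in> Y r" for r a b c
  proof -
    have eq: "b^2 - 4 * a * c = r^2 - 4 * p" using that by (auto simp: Y_def in_forms_disc traces_def)
    have "b^2 = r^2 + 2 * (2 * (a * c) - 2 * p)" using eq by simp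
    then have "even (b^2) = even (r^2)" by simp
    then have "even (r - b)" "even (r + b)" by auto
    then obtain A D where AD: "r - b = 2 * A" "r + b = 2 * D" by (metis evenE)
    then have rb: "r = A + D" "b = D - A" by linarith+
    have "4 * (A * D + a * c) = 4 * p" using eq unfolding rb by (simp add: power2_eq_square algebra_simps)
    then show ?thesis using AD rb by (auto simp: \<Phi>_def)
  qed
  have inj: "inj_on \<Phi> (Sigma (traces p) Y)"
  proof (rule inj_onI)
    fix x y assume xy: "x \<in> Sigma (traces p) Y" "y \<in> Sigma (traces p) Y" "\<Phi> x = \<Phi> y"
    obtain r a b c r' a' b' c' where e: "x = (r, a, b, c)" "y = (r', a', b', c')" by (metis prod_cases4)
    obtain A D where 1: "\<Phi> x = (A, - c, a, D)" "r = A + D" "b = D - A" using inv[of r a b c] xy e by auto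
    obtain A' D' where 2: "\<Phi> y = (A', - c', a', D')" "r' = A' + D'" "b' = D' - A'" using inv[of r' a' b' c'] xy e by auto
    show "x = y" using xy(3) 1 2 e by simp
  qed
  have val: "?H (\<Phi> (r, Q)) = f r * delta_weight Q" and mem: "\<Phi> (r, Q) \<in> mats p"
    if r: "r \<in> traces p" and Q: "Q \<in> Y r" for r Q
  proof -
    obtain a b c where Qe: "Q = (a, b, c)" by (cases Q)
    obtain A D where 1: "\<Phi> (r, Q) = (A, - c, a, D)" "r = A + D" "b = D - A" "A * D + a * c = p"
      using inv[of r a b c] r Q Qe by auto
    have pos: "a > 0" "c > 0" "a + b + c > 0" using forms_disc_pos Q unfolding Qe Y_def by blast+
    have "cyc tau (A, - c, a, D) = delta_weight Q"
      using cyc_tau_definite[of a "-c" D A] pos unfolding Qe 1(3) by (simp add: algebra_simps)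
    then show "?H (\<Phi> (r, Q)) = f r * delta_weight Q" unfolding 1(1) using pos 1(2,3) by auto
    show "\<Phi> (r, Q) \<in> mats p" unfolding 1(1) using 1(4) by (simp add: mats_def mult.commute)
  qed
  have "fsum (mats p) ?H = sum ?H (\<Phi> ` Sigma (traces p) Y)"
  proof (rule fsum_eq_sum)
    show "finite (\<Phi> ` Sigma (traces p) Y)" using finY finite_traces by auto
    show "\<Phi> ` Sigma (traces p) Y \<subseteq> mats p" using mem by auto
    fix M assume M: "M \<in> mats p" "?H M \<noteq> 0"
    obtain A B C D where Me: "M = (A, B, C, D)" by (cases M)
    define x y z where "x = C" and "y = - B" and "z = C + D - A - B"
    have C: "C > 0" and ns: "\<not> some_zero M" and ne: "cyc tau M \<noteq> 0" using M(2) Me by (auto split: if_splits)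
    have pos: "x > 0" "y > 0" "z > 0"
      using cyc_tau_mixed[of A B C D p] C ns ne M(1) p0 unfolding Me x_def y_def z_def by auto
    have def: "(C > 0 \<and> B < 0 \<and> C + D - A - B > 0) \<or> (C < 0 \<and> B > 0 \<and> C + D - A - B < 0)"
      using pos unfolding x_def y_def z_def by auto
    define P R S where "P = x + y - z" and "R = x + z - y" and "S = y + z - x"
    have PRS: "P = A - D" "R = 2 * C + D - A" "S = D - A - 2 * B" by (simp_all add: P_def R_def S_def x_def y_def z_def)
    have w: "sgn P + sgn R + sgn S \<noteq> 1"
      using ne C unfolding Me cyc_tau_definite[OF def] PRS by simp
    have nn: "P \<ge> 0" "R \<ge> 0" "S \<ge> 0"
      using w pos int_sign_cases[of P] int_sign_cases[of R] int_sign_cases[of S] unfolding P_def R_def S_def by linarith+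
    have d: "(A + D)^2 + P * R + P * S + R * S = 4 * p"
      using disc_identity(2)[of A B C D p] M(1) unfolding Me P_def R_def S_def x_def y_def z_def by simp
    \<comment> \<open>The pairwise sums of P, R, S are positive, so at most one of them vanishes;
      hence the discriminant is negative.\<close>
    have "P * R + P * S + R * S > 0"
    proof (cases "P = 0")
      case True
      then have "R > 0" "S > 0" using pos unfolding P_def R_def S_def by linarith+
      then show ?thesis using True by simp
    next
      case False
      then have "P * (R + S) > 0" using nn pos by (intro mult_pos_pos) (auto simp: P_def R_def S_def)
      then show ?thesis using mult_nonneg_nonneg[OF nn(2,3)] by (simp add: distrib_left)
    qed
    then have r: "(A + D)^2 < 4 * p" using d by linarith
    have det: "A * D - B * C = p" using M(1) by (simp add: Me mats_def)
    then have eq: "(D - A)^2 - 4 * C * (- B) = (A + D)^2 - 4 * p" by (simp add: power2_eq_square algebra_simps)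
    have Q: "(C, D - A, - B) \<in> forms_disc (nat (4 * p - (A + D)^2))"
      unfolding in_forms_disc eq using r C by simp
    have "delta_weight (C, D - A, - B) \<noteq> 0"
      using ne C unfolding Me cyc_tau_definite[OF def] by (simp add: algebra_simps)
    then have "(A + D, C, D - A, - B) \<in> Sigma (traces p) Y" using r Q by (simp add: traces_def Y_def)
    moreover have "\<Phi> (A + D, C, D - A, - B) = M" by (simp add: \<Phi>_def Me)
    ultimately show "M \<in> \<Phi> ` Sigma (traces p) Y" by (metis imageI)
  qed
  also have "\<dots> = (\<Sum>x\<in>Sigma (traces p) Y. ?H (\<Phi> x))" by (subst sum.reindex[OF inj]) simp
  also have "\<dots> = (\<Sum>(r, Q)\<in>Sigma (traces p) Y. f r * delta_weight Q)"
  proof (rule sum.cong)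
    fix x assume "x \<in> Sigma (traces p) Y"
    then obtain r Q where "x = (r, Q)" "r \<in> traces p" "Q \<in> Y r" by blast
    then show "?H (\<Phi> x) = (case x of (r, Q) \<Rightarrow> f r * delta_weight Q)" using val[of r Q] by (simp only: prod.case)
  qed simp
  also have "\<dots> = (\<Sum>r\<in>traces p. \<Sum>Q\<in>Y r. f r * delta_weight Q)"
    by (rule sum.Sigma[symmetric]) (use finite_traces finY in auto)
  also have "\<dots> = (\<Sum>r\<in>traces p. f r * fsum (forms_disc (nat (4 * p - r^2))) delta_weight)"
    by (simp add: fsum_def Y_def sum_distrib_left)
  finally show ?thesis using two by simp
qed

lemma nat_disc:
  assumes "r \<in> traces p"
  shows "nat (4 * p - r^2) > 0" "nat (4 * p - r^2) mod 4 = 0 \<or> nat (4 * p - r^2) mod 4 = 3"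
proof -
  have pos: "4 * p - r^2 > 0" using assms by (simp add: traces_def)
  then show "nat (4 * p - r^2) > 0" by simp
  obtain k where k: "r = 2 * k \<or> r = 2 * k + 1" by (metis evenE oddE)
  then have "r^2 = 4 * k^2 \<or> r^2 = 4 * (k^2 + k) + 1" by (auto simp: power2_eq_square algebra_simps)
  then have "(4 * p - r^2) mod 4 = 0 \<or> (4 * p - r^2) mod 4 = 3" by presburger
  then show "nat (4 * p - r^2) mod 4 = 0 \<or> nat (4 * p - r^2) mod 4 = 3"
    using pos by (metis nat_0_iff nat_mod_distrib nat_numeral order.strict_iff_not nle_le zero_le_numeral nat_zero_as_int)
qed

text \<open>The factor 12 is 2 for the sign of M times 6 from \<open>hurwitz_eq_fsum\<close>.
  Matrices fixing a vertex carry weight in \<open>cyc tau\<close> but belong to no definite form, so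
  they are subtracted.\<close>

lemma hurwitz_sum:
  fixes f :: "int \<Rightarrow> int"
  assumes p: "prime p" and f: "\<And>r. f (- r) = f r"
  shows "12 * (\<Sum>r\<in>traces p. real_of_int (f r) * hurwitz (nat (4 * p - r^2))) =
    real_of_int (fsum (mats p) (\<lambda>M. f (tr M) * cyc tau M) - fsum (mats p) (\<lambda>M. f (tr M) * (of_bool (some_zero M) * cyc tau M)))"
proof -
  note fin = fin_supp_cyc_tau[OF p]
  have "fsum (mats p) (\<lambda>M. f (tr M) * cyc tau M) - fsum (mats p) (\<lambda>M. f (tr M) * (of_bool (some_zero M) * cyc tau M)) =
    fsum (mats p) (\<lambda>M. f (tr M) * cyc tau M - f (tr M) * (of_bool (some_zero M) * cyc tau M))"
    by (rule fsum_diff[symmetric]) (intro fin_supp_mult fin)+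
  also have "\<dots> = fsum (mats p) (\<lambda>M. f (tr M) * of_bool (\<not> some_zero M) * cyc tau M)"
    by (rule fsum_cong) simp
  also have "\<dots> = 2 * (\<Sum>r\<in>traces p. f r * fsum (forms_disc (nat (4 * p - r^2))) delta_weight)"
    by (rule sum_traces_eq_fsum[where f = f, OF p]) (rule f)
  finally have "real_of_int (fsum (mats p) (\<lambda>M. f (tr M) * cyc tau M) - fsum (mats p) (\<lambda>M. f (tr M) * (of_bool (some_zero M) * cyc tau M)))
    = 2 * (\<Sum>r\<in>traces p. real_of_int (f r) * real_of_int (fsum (forms_disc (nat (4 * p - r^2))) delta_weight))"
    by simp
  also have "\<dots> = 2 * (\<Sum>r\<in>traces p. real_of_int (f r) * (6 * hurwitz (nat (4 * p - r^2))))"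
    using hurwitz_eq_fsum[OF nat_disc] by simp
  finally show ?thesis by (simp add: sum_distrib_left mult.left_commute)
qed

text \<open>A power of \<open>conjU\<close> makes the matrix upper triangular, and its diagonal
  entries are then 1 and p up to a common sign.\<close>

lemma trace_some_zero:
  assumes p: "prime p" and M: "M \<in> mats p" and z: "some_zero M"
  shows "tr M = p + 1 \<or> tr M = - (p + 1)"
proof -
  have *: "tr N = p + 1 \<or> tr N = - (p + 1)" if N: "N \<in> mats p" "fst (snd (snd N)) = 0" for N
  proof -
    obtain A B D where Ne: "N = (A, B, 0, D)" using N(2) by (cases N) auto
    then have "(A, D) \<in> {(1, p), (p, 1), (-1, -p), (-p, -1)}"
      using N(1) by (intro prime_factor_cases p) (simp add: mats_def)
    then show ?thesis unfolding Ne by auto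
  qed
  obtain A B C D where Me: "M = (A, B, C, D)" by (cases M)
  consider "C = 0" | "B = 0" | "C + D - A - B = 0" using z by (auto simp: Me)
  then show ?thesis
  proof cases
    case 1 then show ?thesis using *[OF M] by (simp add: Me)
  next
    case 2
    then have "fst (snd (snd (conjU (conjU M)))) = 0" unfolding Me conjU_conjU by simp
    then show ?thesis using *[of "conjU (conjU M)"] M by (simp add: mats_closed tr_conjU)
  next
    case 3
    then have "fst (snd (snd (conjU M))) = 0" unfolding Me by simp
    then show ?thesis using *[of "conjU M"] M by (simp add: mats_closed tr_conjU)
  qed
qed

section \<open>Class number sums over all traces and over those divisible by 3\<close>

lemma hurwitz_sum_all:
  assumes p: "prime p"
  shows "(\<Sum>r\<in>traces p. hurwitz (nat (4 * p - r^2))) = 2 * real_of_int p"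
  \<comment> \<open>The matrices fixing a vertex contribute -12(p - 1), so twelve times the sum is
    12(p + 1) + 12(p - 1) = 24p.\<close>
  using hurwitz_sum[OF p, of "\<lambda>_. 1"] fsum_cyc_tau[OF p] fsum_split_some_zero[OF p] fsum_triangular[OF p]
  by simp

lemma hurwitz_sum_dvd:
  assumes p: "prime p"
  defines "S \<equiv> (\<Sum>r\<in>traces p. of_bool (3 dvd r) * hurwitz (nat (4 * p - r^2)))"
  shows "p mod 3 = 1 \<Longrightarrow> S = (real_of_int p + 1) / 2" and "p mod 3 = 2 \<Longrightarrow> S = real_of_int p - 1"
proof -
  let ?X = "mats p"
  let ?f = "\<lambda>r :: int. of_bool (3 dvd r) :: int"
  note fin = fin_supp_mult[OF fin_supp_cyc_tau[OF p]]
  have S: "12 * S = real_of_int (fsum ?X (\<lambda>M. ?f (tr M) * cyc tau M) - fsum ?X (\<lambda>M. ?f (tr M) * (of_bool (some_zero M) * cyc tau M)))"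
    using hurwitz_sum[OF p, of ?f] unfolding S_def by simp
  show "S = (real_of_int p + 1) / 2" if p1: "p mod 3 = 1"
  proof -
    have nd: "\<not> 3 dvd p" using p1 by presburger
    have "fsum ?X (\<lambda>M. ?f (tr M) * (of_bool (some_zero M) * cyc tau M)) = fsum ?X (\<lambda>M. 0)"
    proof (rule fsum_cong)
      fix M assume M: "M \<in> ?X"
      \<comment> \<open>The traces are p + 1 and its negative, congruent to 2 and 1 modulo
        3.\<close>
      have "\<not> 3 dvd tr M" if "some_zero M" using trace_some_zero[OF p M that] p1 by presburger
      then show "?f (tr M) * (of_bool (some_zero M) * cyc tau M) = 0" by auto
    qed
    then have z: "fsum ?X (\<lambda>M. ?f (tr M) * (of_bool (some_zero M) * cyc tau M)) = 0" by (simp add: fsum_def)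
    have "4 * fsum ?X (\<lambda>M. ?f (tr M) * cyc tau M) = fsum ?X (\<lambda>M. 4 * (?f (tr M) * cyc tau M))"
      by (rule fsum_mult[symmetric])
    also have "\<dots> = fsum ?X (\<lambda>M. 1 * cyc tau M + (3 * of_bool (quat M)) * cyc tau M - fixed_lines M * cyc tau M)"
    proof (rule fsum_cong)
      fix M assume "M \<in> ?X"
      then have "4 * ?f (tr M) = 1 + 3 * of_bool (quat M) - fixed_lines M" using trace_indicator_1[OF _ p1] by simp
      then show "4 * (?f (tr M) * cyc tau M) = 1 * cyc tau M + (3 * of_bool (quat M)) * cyc tau M - fixed_lines M * cyc tau M"
        by (simp only: mult.assoc[symmetric] distrib_right left_diff_distrib)
    qed
    also have "\<dots> = fsum ?X (\<lambda>M. 1 * cyc tau M) + fsum ?X (\<lambda>M. (3 * of_bool (quat M)) * cyc tau M) - fsum ?X (\<lambda>M. fixed_lines M * cyc tau M)"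
      by (simp only: fsum_diff[OF fin_supp_add[OF fin fin] fin] fsum_add[OF fin fin])
    \<comment> \<open>The first two sums are 12(p + 1) each, and the sum over fixed lines is
      0.\<close>
    also have "\<dots> = 24 * (p + 1)"
      using fsum_quat_cyc_tau[OF p p1] fsum_fixed_lines_cyc_tau[OF p nd] fsum_cyc_tau[OF p]
        fsum_mult[of ?X 3 "\<lambda>M. of_bool (quat M) * cyc tau M"] by (simp add: mult.assoc)
    finally show ?thesis using S unfolding z by simp
  qed
  show "S = real_of_int p - 1" if p2: "p mod 3 = 2"
  proof -
    have nd: "\<not> 3 dvd p" using p2 by presburger
    have "fsum ?X (\<lambda>M. ?f (tr M) * (of_bool (some_zero M) * cyc tau M)) = fsum ?X (\<lambda>M. of_bool (some_zero M) * cyc tau M)"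
    proof (rule fsum_cong)
      fix M assume M: "M \<in> ?X"
      \<comment> \<open>Here 3 divides p + 1, so all matrices fixing a vertex are subtracted; they
        account for the whole value p - 1.\<close>
      have "3 dvd tr M" if "some_zero M" using trace_some_zero[OF p M that] p2 by presburger
      then show "?f (tr M) * (of_bool (some_zero M) * cyc tau M) = of_bool (some_zero M) * cyc tau M" by auto
    qed
    then have z: "fsum ?X (\<lambda>M. ?f (tr M) * (of_bool (some_zero M) * cyc tau M)) = -12 * (p - 1)"
      using fsum_split_some_zero[OF p] fsum_triangular[OF p] by simp
    have "2 * fsum ?X (\<lambda>M. ?f (tr M) * cyc tau M) = fsum ?X (\<lambda>M. 2 * (?f (tr M) * cyc tau M))"
      by (rule fsum_mult[symmetric])
    also have "\<dots> = fsum ?X (\<lambda>M. fixed_lines M * cyc tau M)"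
    proof (rule fsum_cong)
      fix M assume "M \<in> ?X"
      then have "2 * ?f (tr M) = fixed_lines M" using trace_indicator_2[OF _ p2] by simp
      then show "2 * (?f (tr M) * cyc tau M) = fixed_lines M * cyc tau M"
        by (simp only: mult.assoc[symmetric])
    qed
    also have "\<dots> = 0" by (rule fsum_fixed_lines_cyc_tau[OF p nd])
    finally show ?thesis using S unfolding z by simp
  qed
qed

theorem theorem3:
  fixes p :: nat and c :: int
  assumes "prime p"
  defines "S \<equiv> (\<Sum>r\<in>{r::int. \<bar>real_of_int r\<bar> < 2 * sqrt (real p) \<and> r mod 3 = c mod 3}.
                    hurwitz (nat (4 * int p - r^2)))"
  shows "(c mod 3 = 0 \<and> p mod 3 = 1 \<longrightarrow> S = (real p + 1) / 2)
       \<and> (c mod 3 = 0 \<and> p mod 3 = 2 \<longrightarrow> S = real p - 1)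
       \<and> ((c mod 3 = 1 \<or> c mod 3 = 2) \<and> p mod 3 = 1 \<longrightarrow> S = (3 * real p - 1) / 4)
       \<and> ((c mod 3 = 1 \<or> c mod 3 = 2) \<and> p mod 3 = 2 \<longrightarrow> S = (real p + 1) / 2)"
proof -
  have ip: "prime (int p)" using assms(1) by simp
  let ?h = "\<lambda>r. hurwitz (nat (4 * int p - r^2))"
  define T where "T k = (\<Sum>r\<in>{r\<in>traces (int p). r mod 3 = k}. ?h r)" for k :: int
  have set_eq: "{r::int. \<bar>real_of_int r\<bar> < 2 * sqrt (real p) \<and> r mod 3 = c mod 3} = {r\<in>traces (int p). r mod 3 = c mod 3}"
  proof -
    have "\<bar>real_of_int r\<bar> < 2 * sqrt (real p) \<longleftrightarrow> r^2 < 4 * int p" for r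
    proof -
      have "\<bar>real_of_int r\<bar> < 2 * sqrt (real p) \<longleftrightarrow> sqrt ((real_of_int r)^2) < sqrt (4 * real p)"
        by (simp add: real_sqrt_mult)
      also have "\<dots> \<longleftrightarrow> (real_of_int r)^2 < 4 * real p" by (rule real_sqrt_less_iff)
      also have "\<dots> \<longleftrightarrow> real_of_int (r^2) < real_of_int (4 * int p)" by simp
      finally show ?thesis unfolding of_int_less_iff .
    qed
    then show ?thesis by (simp add: traces_def)
  qed
  have ST: "S = T (c mod 3)" unfolding S_def T_def set_eq ..
  \<comment> \<open>Negating r exchanges the residues 1 and 2. Together with the total 2p, the value
    of \<open>T 0\<close> therefore determines the other two.\<close>
  have "T 1 = T 2"
    unfolding T_def
    by (rule sum.reindex_bij_witness[of _ uminus uminus]) (auto simp: traces_def, presburger+)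
  moreover have "T 0 + T 1 + T 2 = 2 * real p"
  proof -
    have "T k = (\<Sum>r\<in>traces (int p). if r mod 3 = k then ?h r else 0)" for k
      unfolding T_def by (rule sum.mono_neutral_cong_left[OF finite_traces]) auto
    then have "T 0 + T 1 + T 2 = (\<Sum>r\<in>traces (int p). (if r mod 3 = 0 then ?h r else 0) + (if r mod 3 = 1 then ?h r else 0)
      + (if r mod 3 = 2 then ?h r else 0))"
      by (simp only: sum.distrib)
    also have "\<dots> = (\<Sum>r\<in>traces (int p). ?h r)"
    proof (rule sum.cong)
      fix r :: int
      have "r mod 3 = 0 \<or> r mod 3 = 1 \<or> r mod 3 = 2" by presburger
      then show "(if r mod 3 = 0 then ?h r else 0) + (if r mod 3 = 1 then ?h r else 0) + (if r mod 3 = 2 then ?h r else 0) = ?h r"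
        by auto
    qed simp
    finally show ?thesis using hurwitz_sum_all[OF ip] by simp
  qed
  moreover have T0: "T 0 = (\<Sum>r\<in>traces (int p). of_bool (3 dvd r) * ?h r)"
    unfolding T_def by (rule sum.mono_neutral_cong_left[OF finite_traces]) (auto simp: dvd_eq_mod_eq_0)
  moreover have "p mod 3 = 1 \<Longrightarrow> T 0 = (real p + 1) / 2" "p mod 3 = 2 \<Longrightarrow> T 0 = real p - 1"
  proof -
    have "int p mod 3 = 1" if "p mod 3 = 1" using that by presburger
    then show "p mod 3 = 1 \<Longrightarrow> T 0 = (real p + 1) / 2" using hurwitz_sum_dvd(1)[OF ip] unfolding T0 by simp
    have "int p mod 3 = 2" if "p mod 3 = 2" using that by presburger
    then show "p mod 3 = 2 \<Longrightarrow> T 0 = real p - 1" using hurwitz_sum_dvd(2)[OF ip] unfolding T0 by simp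
  qed
  ultimately show ?thesis unfolding ST by (auto simp: field_simps)
qed

end
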